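(* Let $w\in\{l,p,c\}$. Let $\mathbb{A}$ be an $\mathcal{F}$-category which admits $\bar{w}$-limits of loose morphisms. Then the inclusion of tight morphisms $j:\mathcal{A}_\tau\to\mathbb{A}$ is orthogonal to each $w$-doctrinal $\mathcal{F}$-functor; that is, for every $w$-doctrinal $\mathcal{F}$-functor $H:\mathbb{B}\to\mathbb{C}$ and all $\mathcal{F}$-functors $R:\mathcal{A}_\tau\to\mathbb{B}$ and $S:\mathbb{A}\to\mathbb{C}$ with $HR=Sj$, there exists a unique $\mathcal{F}$-functor $K:\mathbb{A}\to\mathbb{B}$ with $Kj=R$ and $HK=S$.
   Context: **$\mathcal{F}$-categories.** An $\mathcal{F}$-category $\mathbb{A}$ is a pair of 2-categories $\mathcal{A}_\tau,\mathcal{A}_\lambda$ with a 2-functor $j:\mathcal{A}_\tau\to\mathcal{A}_\lambda$ that is the identity on objects, faithful (injective on 1-cells) and locally fully faithful. The 1-cells of $\mathcal{A}_\lambda$ are the loose morphisms (written $A\rightsquigarrow B$); those coming from $\mathcal{A}_\tau$ are the tight morphisms (written $A\to B$). An $\mathcal{F}$-functor $F:\mathbb{A}\to\mathbb{B}$ is a 2-functor $F_\lambda:\mathcal{A}_\lambda\to\mathcal{B}_\lambda$ taking tight morphisms to tight morphisms; $F_\tau:\mathcal{A}_\tau\to\mathcal{B}_\tau$ is its restriction. A 2-category is viewed as an $\mathcal{F}$-category in which all morphisms are tight. Thus there is an $\mathcal{F}$-functor $j:\mathcal{A}_\tau\to\mathbb{A}$, the identity on tight morphisms and given by $j:\mathcal{A}_\tau\to\mathcal{A}_\lambda$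 on loose ones. $\mathbb{A}^{co}$ is obtained by reversing 2-cells. An adjunction $(\epsilon,f\dashv g,\eta)$ in $\mathbb{A}$ means an adjunction in $\mathcal{A}_\lambda$ (counit $\epsilon$, unit $\eta$). **Reflections.** An $l$-reflection $(1,f\dashv g,\eta)$ is an adjunction with tight left adjoint $f$ and identity counit; it is a $p$-reflection if moreover $\eta$ is invertible. For $w\in\{l,p\}$, given $w$-reflections $(1,f_i\dashv g_i,\eta_i)$, $i=1,2$, a tight commuting square $(r,s):f_1\to f_2$ (i.e. $r,s$ tight with $f_2r=sf_1$) is a morphism of $w$-reflections if $g_2s=rg_1$ and $r\eta_1=\eta_2r$. **$w$-doctrinal.** For $w\in\{l,p\}$ an $\mathcal{F}$-functor $H:\mathbb{A}\to\mathbb{B}$ satisfies - $w$-Refl if for each tight $f$ in $\mathbb{A}$, each $w$-reflection $(1,Hf\dashv g,\eta)$ in $\mathbb{B}$ lifts uniquely along $H$ to a $w$-reflection $(1,f\dashv g',\eta')$ in $\mathbb{A}$ (so $Hg'=g$, $H\eta'=\eta$); - $w$-Morph if, given $w$-reflections $(1,f_i\dashv g_i,\eta_i)$ in $\mathbb{A}$, $i=1,2$, a tight commuting square $(r,s):f_1\to f_2$ is a morphism of $w$-reflections just when $(Hr,Hs):Hf_1\to Hf_2$ is one. $H$ satisfies $c$-Refl or $c$-Morph if $H^{co}:\mathbb{A}^{co}\to\mathbb{B}^{co}$ satisfies $l$-Refl or $l$-Morph. For $w\in\{l,p,c\}$, $H$ is $w$-doctrinal if it satisfies $w$-Refl, $w$-Morph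 and is locally faithful, i.e. $H_\lambda$ reflects equality of parallel 2-cells. **Limits of loose morphisms.** Put $\bar{l}=c$, $\bar{p}=p$, $\bar{c}=l$. The colax limit ($c$-limit) of a loose $f:A\rightsquigarrow B$ consists of an object $C_f$, tight morphisms $p_f:C_f\to A$, $q_f:C_f\to B$ and a 2-cell $\lambda_f:q_f\Rightarrow fp_f$ such that: (1) for every colax cone $(r:X\rightsquigarrow A,\ \alpha:s\Rightarrow fr,\ s:X\rightsquigarrow B)$ there is a unique $t:X\rightsquigarrow C_f$ with $p_ft=r$, $q_ft=s$, $\lambda_ft=\alpha$; (2) given colax cones $(r,\alpha,s)$, $(r',\alpha',s')$ from $X$, with induced $t,t'$, and 2-cells $\theta_r:r\Rightarrow r'$, $\theta_s:s\Rightarrow s'$ with $\alpha'\circ\theta_s=(f\theta_r)\circ\alpha$, there is a unique 2-cell $\phi:t\Rightarrow t'$ with $p_f\phi=\theta_r$, $q_f\phi=\theta_s$; (3) $t:X\rightsquigarrow C_f$ is tight just when $p_ft$ and $q_ft$ are tight. The pseudolimit ($p$-limit) is defined in the same way with $\lambda_f$ and the 2-cells $\alpha$ of all cones required invertible. The lax limit ($l$-limit) of $f$ in $\mathbb{A}$ is the colax limit of $f$ in $\mathbb{A}^{co}$. *)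

theory Defs
  imports "HOL-Library.FuncSet"
begin

section \<open>2-categories and 2-functors\<close>

text \<open>
  Composites are written in the usual order: for \<open>f : x \<rightarrow> y\<close> and \<open>g : y \<rightarrow> z\<close> the composite is
  \<open>g \<cdot> f\<close>; for 2-cells, \<open>\<beta> \<bullet> \<alpha>\<close> is the vertical and \<open>\<beta> \<star> \<alpha>\<close> the horizontal composite.
\<close>

record ('o, 'a, 'c) twocat =
  Ob :: "'o set"
  Arr :: "'a set"
  Cell :: "'c set"
  dom1 :: "'a \<Rightarrow> 'o"
  cod1 :: "'a \<Rightarrow> 'o"
  id1 :: "'o \<Rightarrow> 'a"
  comp1 :: "'a \<Rightarrow> 'a \<Rightarrow> 'a"  (infixr "\<cdot>\<index>" 75)
  src :: "'c \<Rightarrow> 'a"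
  trg :: "'c \<Rightarrow> 'a"
  id2 :: "'a \<Rightarrow> 'c"
  vcomp :: "'c \<Rightarrow> 'c \<Rightarrow> 'c"  (infixr "\<bullet>\<index>" 70)
  hcomp :: "'c \<Rightarrow> 'c \<Rightarrow> 'c"  (infixr "\<star>\<index>" 75)

definition is_arr :: "('o, 'a, 'c) twocat \<Rightarrow> 'a \<Rightarrow> 'o \<Rightarrow> 'o \<Rightarrow> bool" where
  "is_arr A f x y \<longleftrightarrow> f \<in> Arr A \<and> dom1 A f = x \<and> cod1 A f = y"

definition is_cell :: "('o, 'a, 'c) twocat \<Rightarrow> 'c \<Rightarrow> 'a \<Rightarrow> 'a \<Rightarrow> bool" where
  "is_cell A \<alpha> f g \<longleftrightarrow> \<alpha> \<in> Cell A \<and> src A \<alpha> = f \<and> trg A \<alpha> = g"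

definition parallel1 :: "('o, 'a, 'c) twocat \<Rightarrow> 'a \<Rightarrow> 'a \<Rightarrow> bool" where
  "parallel1 A f g \<longleftrightarrow> f \<in> Arr A \<and> g \<in> Arr A \<and> dom1 A f = dom1 A g \<and> cod1 A f = cod1 A g"

locale two_category =
  fixes A :: "('o, 'a, 'c) twocat" (structure)
  assumes dom_in: "f \<in> Arr A \<Longrightarrow> dom1 A f \<in> Ob A"
    and cod_in: "f \<in> Arr A \<Longrightarrow> cod1 A f \<in> Ob A"
    and id1_arr: "x \<in> Ob A \<Longrightarrow> is_arr A (id1 A x) x x"
    and comp1_arr: "\<lbrakk>is_arr A f x y; is_arr A g y z\<rbrakk> \<Longrightarrow> is_arr A (g \<cdot> f) x z"
    and comp1_assoc: "\<lbrakk>is_arr A f w x; is_arr A g x y; is_arr A h y z\<rbrakk>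
          \<Longrightarrow> (h \<cdot> g) \<cdot> f = h \<cdot> (g \<cdot> f)"
    and id1_left: "is_arr A f x y \<Longrightarrow> id1 A y \<cdot> f = f"
    and id1_right: "is_arr A f x y \<Longrightarrow> f \<cdot> id1 A x = f"
    and src_trg_parallel: "\<alpha> \<in> Cell A \<Longrightarrow> parallel1 A (src A \<alpha>) (trg A \<alpha>)"
    and id2_cell: "f \<in> Arr A \<Longrightarrow> is_cell A (id2 A f) f f"
    and vcomp_cell: "\<lbrakk>is_cell A \<alpha> f g; is_cell A \<beta> g h\<rbrakk> \<Longrightarrow> is_cell A (\<beta> \<bullet> \<alpha>) f h"
    and vcomp_assoc: "\<lbrakk>is_cell A \<alpha> f g; is_cell A \<beta> g h; is_cell A \<gamma> h k\<rbrakk>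
          \<Longrightarrow> (\<gamma> \<bullet> \<beta>) \<bullet> \<alpha> = \<gamma> \<bullet> (\<beta> \<bullet> \<alpha>)"
    and id2_left: "is_cell A \<alpha> f g \<Longrightarrow> id2 A g \<bullet> \<alpha> = \<alpha>"
    and id2_right: "is_cell A \<alpha> f g \<Longrightarrow> \<alpha> \<bullet> id2 A f = \<alpha>"
    and hcomp_cell: "\<lbrakk>is_cell A \<alpha> f f'; is_cell A \<beta> g g'; cod1 A f = dom1 A g\<rbrakk>
          \<Longrightarrow> is_cell A (\<beta> \<star> \<alpha>) (g \<cdot> f) (g' \<cdot> f')"
    and hcomp_assoc: "\<lbrakk>is_cell A \<alpha> f f'; is_cell A \<beta> g g'; is_cell A \<gamma> h h';
          cod1 A f = dom1 A g; cod1 A g = dom1 A h\<rbrakk>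
          \<Longrightarrow> (\<gamma> \<star> \<beta>) \<star> \<alpha> = \<gamma> \<star> (\<beta> \<star> \<alpha>)"
    and hcomp_unit_left: "is_cell A \<alpha> f f' \<Longrightarrow> id2 A (id1 A (cod1 A f)) \<star> \<alpha> = \<alpha>"
    and hcomp_unit_right: "is_cell A \<alpha> f f' \<Longrightarrow> \<alpha> \<star> id2 A (id1 A (dom1 A f)) = \<alpha>"
    and hcomp_id2: "\<lbrakk>is_arr A f x y; is_arr A g y z\<rbrakk> \<Longrightarrow> id2 A g \<star> id2 A f = id2 A (g \<cdot> f)"
    and interchange: "\<lbrakk>is_cell A \<alpha> f f'; is_cell A \<alpha>' f' f''; is_cell A \<beta> g g'; is_cell A \<beta>' g' g'';
          cod1 A f = dom1 A g\<rbrakk>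
          \<Longrightarrow> (\<beta>' \<bullet> \<beta>) \<star> (\<alpha>' \<bullet> \<alpha>) = (\<beta>' \<star> \<alpha>') \<bullet> (\<beta> \<star> \<alpha>)"

definition whisker_left :: "('o, 'a, 'c) twocat \<Rightarrow> 'a \<Rightarrow> 'c \<Rightarrow> 'c" where
  "whisker_left A f \<theta> = id2 A f \<star>\<^bsub>A\<^esub> \<theta>"

definition whisker_right :: "('o, 'a, 'c) twocat \<Rightarrow> 'c \<Rightarrow> 'a \<Rightarrow> 'c" where
  "whisker_right A \<theta> t = \<theta> \<star>\<^bsub>A\<^esub> id2 A t"

definition invertible_cell :: "('o, 'a, 'c) twocat \<Rightarrow> 'c \<Rightarrow> bool" where
  "invertible_cell A \<alpha> \<longleftrightarrow> \<alpha> \<in> Cell A \<and>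
     (\<exists>\<beta>. is_cell A \<beta> (trg A \<alpha>) (src A \<alpha>) \<and>
          \<beta> \<bullet>\<^bsub>A\<^esub> \<alpha> = id2 A (src A \<alpha>) \<and> \<alpha> \<bullet>\<^bsub>A\<^esub> \<beta> = id2 A (trg A \<alpha>))"

record ('o, 'a, 'c, 'o2, 'a2, 'c2) twofun =
  F0 :: "'o \<Rightarrow> 'o2"
  F1 :: "'a \<Rightarrow> 'a2"
  F2 :: "'c \<Rightarrow> 'c2"

text \<open>
  The three components of a 2-functor are required to be extensional (\<open>undefined\<close> off the carrier),
  so that equality of 2-functors is equality of records.
\<close>

definition two_functor ::
  "('o, 'a, 'c) twocat \<Rightarrow> ('o2, 'a2, 'c2) twocat \<Rightarrow> ('o, 'a, 'c, 'o2, 'a2, 'c2) twofun \<Rightarrow> bool" where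
  "two_functor A B F \<longleftrightarrow>
     F0 F \<in> Ob A \<rightarrow>\<^sub>E Ob B \<and> F1 F \<in> Arr A \<rightarrow>\<^sub>E Arr B \<and> F2 F \<in> Cell A \<rightarrow>\<^sub>E Cell B \<and>
     (\<forall>f\<in>Arr A. dom1 B (F1 F f) = F0 F (dom1 A f) \<and> cod1 B (F1 F f) = F0 F (cod1 A f)) \<and>
     (\<forall>x\<in>Ob A. F1 F (id1 A x) = id1 B (F0 F x)) \<and>
     (\<forall>f\<in>Arr A. \<forall>g\<in>Arr A. cod1 A f = dom1 A g \<longrightarrow>
        F1 F (g \<cdot>\<^bsub>A\<^esub> f) = F1 F g \<cdot>\<^bsub>B\<^esub> F1 F f) \<and>
     (\<forall>\<alpha>\<in>Cell A. src B (F2 F \<alpha>) = F1 F (src A \<alpha>) \<and> trg B (F2 F \<alpha>) = F1 F (trg A \<alpha>)) \<and>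
     (\<forall>f\<in>Arr A. F2 F (id2 A f) = id2 B (F1 F f)) \<and>
     (\<forall>\<alpha>\<in>Cell A. \<forall>\<beta>\<in>Cell A. trg A \<alpha> = src A \<beta> \<longrightarrow>
        F2 F (\<beta> \<bullet>\<^bsub>A\<^esub> \<alpha>) = F2 F \<beta> \<bullet>\<^bsub>B\<^esub> F2 F \<alpha>) \<and>
     (\<forall>\<alpha>\<in>Cell A. \<forall>\<beta>\<in>Cell A. cod1 A (src A \<alpha>) = dom1 A (src A \<beta>) \<longrightarrow>
        F2 F (\<beta> \<star>\<^bsub>A\<^esub> \<alpha>) = F2 F \<beta> \<star>\<^bsub>B\<^esub> F2 F \<alpha>)"

definition two_id :: "('o, 'a, 'c) twocat \<Rightarrow> ('o, 'a, 'c, 'o, 'a, 'c) twofun" where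
  "two_id A = \<lparr>F0 = restrict id (Ob A), F1 = restrict id (Arr A), F2 = restrict id (Cell A)\<rparr>"

definition two_comp ::
  "('o, 'a, 'c) twocat \<Rightarrow> ('o2, 'a2, 'c2, 'o3, 'a3, 'c3) twofun
    \<Rightarrow> ('o, 'a, 'c, 'o2, 'a2, 'c2) twofun \<Rightarrow> ('o, 'a, 'c, 'o3, 'a3, 'c3) twofun" where
  "two_comp A G F = \<lparr>F0 = compose (Ob A) (F0 G) (F0 F), F1 = compose (Arr A) (F1 G) (F1 F),
                     F2 = compose (Cell A) (F2 G) (F2 F)\<rparr>"

definition two_co :: "('o, 'a, 'c) twocat \<Rightarrow> ('o, 'a, 'c) twocat" where
  "two_co A = A\<lparr>src := trg A, trg := src A, vcomp := (\<lambda>\<beta> \<alpha>. \<alpha> \<bullet>\<^bsub>A\<^esub> \<beta>)\<rparr>"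

definition adjunction ::
  "('o, 'a, 'c) twocat \<Rightarrow> 'c \<Rightarrow> 'a \<Rightarrow> 'a \<Rightarrow> 'c \<Rightarrow> bool" where
  "adjunction A \<epsilon> f g \<eta> \<longleftrightarrow>
     (\<exists>x y. is_arr A f x y \<and> is_arr A g y x \<and>
        is_cell A \<epsilon> (f \<cdot>\<^bsub>A\<^esub> g) (id1 A y) \<and> is_cell A \<eta> (id1 A x) (g \<cdot>\<^bsub>A\<^esub> f)) \<and>
     whisker_right A \<epsilon> f \<bullet>\<^bsub>A\<^esub> whisker_left A f \<eta> = id2 A f \<and>
     whisker_left A g \<epsilon> \<bullet>\<^bsub>A\<^esub> whisker_right A \<eta> g = id2 A g"


section \<open>F-categories\<close>

record ('o, 't1, 't2, 'l1, 'l2) fcat =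
  tight_cat :: "('o, 't1, 't2) twocat"
  loose_cat :: "('o, 'l1, 'l2) twocat"
  incl :: "('o, 't1, 't2, 'o, 'l1, 'l2) twofun"

definition F_category :: "('o, 't1, 't2, 'l1, 'l2) fcat \<Rightarrow> bool" where
  "F_category A \<longleftrightarrow>
     two_category (tight_cat A) \<and> two_category (loose_cat A) \<and>
     two_functor (tight_cat A) (loose_cat A) (incl A) \<and>
     Ob (tight_cat A) = Ob (loose_cat A) \<and> (\<forall>x\<in>Ob (tight_cat A). F0 (incl A) x = x) \<and>
     inj_on (F1 (incl A)) (Arr (tight_cat A)) \<and>
     (\<forall>f g. parallel1 (tight_cat A) f g \<longrightarrow>
        bij_betw (F2 (incl A)) {\<alpha>. is_cell (tight_cat A) \<alpha> f g}
          {\<alpha>. is_cell (loose_cat A) \<alpha> (F1 (incl A) f) (F1 (incl A) g)})"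

text \<open>The tight morphisms, regarded as 1-cells of the 2-category of loose morphisms.\<close>

definition Tight :: "('o, 't1, 't2, 'l1, 'l2) fcat \<Rightarrow> 'l1 set" where
  "Tight A = F1 (incl A) ` Arr (tight_cat A)"

text \<open>
  An F-functor is given by its action on the loose 2-categories. Its restriction to the tight parts
  is determined by it, because the inclusions are injective on 1-cells and locally fully faithful;
  so equality of F-functors is equality of their loose parts.
\<close>

definition F_functor ::
  "('o, 't1, 't2, 'l1, 'l2) fcat \<Rightarrow> ('o2, 't1b, 't2b, 'l1b, 'l2b) fcat
    \<Rightarrow> ('o, 'l1, 'l2, 'o2, 'l1b, 'l2b) twofun \<Rightarrow> bool" where
  "F_functor A B F \<longleftrightarrow> two_functor (loose_cat A) (loose_cat B) F \<and> F1 F ` Tight A \<subseteq> Tight B"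

definition F_comp ::
  "('o, 't1, 't2, 'l1, 'l2) fcat \<Rightarrow> ('o2, 'a2, 'c2, 'o3, 'a3, 'c3) twofun
    \<Rightarrow> ('o, 'l1, 'l2, 'o2, 'a2, 'c2) twofun \<Rightarrow> ('o, 'l1, 'l2, 'o3, 'a3, 'c3) twofun" where
  "F_comp A G F = two_comp (loose_cat A) G F"

text \<open>A 2-category as an F-category in which every morphism is tight.\<close>

definition all_tight :: "('o, 'a, 'c) twocat \<Rightarrow> ('o, 'a, 'c, 'a, 'c) fcat" where
  "all_tight A = \<lparr>tight_cat = A, loose_cat = A, incl = two_id A\<rparr>"

text \<open>
  Reversing 2-cells leaves the underlying functions of a 2-functor unchanged, so the inclusion is
  kept, and likewise \<open>H\<^sup>c\<^sup>o\<close> is given by the same record as \<open>H\<close>.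
\<close>

definition F_co :: "('o, 't1, 't2, 'l1, 'l2) fcat \<Rightarrow> ('o, 't1, 't2, 'l1, 'l2) fcat" where
  "F_co A = \<lparr>tight_cat = two_co (tight_cat A), loose_cat = two_co (loose_cat A), incl = incl A\<rparr>"


section \<open>Reflections and doctrinal F-functors\<close>

datatype flavour = Lax | Pseudo | Colax

primrec bar :: "flavour \<Rightarrow> flavour" where
  "bar Lax = Colax"
| "bar Pseudo = Pseudo"
| "bar Colax = Lax"

text \<open>
  The boolean selects the pseudo variant: \<open>reflection False\<close> is an l-reflection, \<open>reflection True\<close>
  a p-reflection. With \<open>y\<close> the codomain of \<open>f\<close>, taking the identity on \<open>1\<^sub>y\<close> as counit forces
  \<open>f \<cdot> g = 1\<^sub>y\<close>.
\<close>

definition reflection ::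
  "bool \<Rightarrow> ('o, 't1, 't2, 'l1, 'l2) fcat \<Rightarrow> 'l1 \<Rightarrow> 'l1 \<Rightarrow> 'l2 \<Rightarrow> bool" where
  "reflection p A f g \<eta> \<longleftrightarrow> (let L = loose_cat A in
     f \<in> Tight A \<and> adjunction L (id2 L (id1 L (cod1 L f))) f g \<eta> \<and>
     (p \<longrightarrow> invertible_cell L \<eta>))"

definition tight_square ::
  "('o, 't1, 't2, 'l1, 'l2) fcat \<Rightarrow> 'l1 \<Rightarrow> 'l1 \<Rightarrow> 'l1 \<Rightarrow> 'l1 \<Rightarrow> bool" where
  "tight_square A f1 f2 r s \<longleftrightarrow> (let L = loose_cat A in
     f1 \<in> Tight A \<and> f2 \<in> Tight A \<and> r \<in> Tight A \<and> s \<in> Tight A \<and>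
     is_arr L r (dom1 L f1) (dom1 L f2) \<and> is_arr L s (cod1 L f1) (cod1 L f2) \<and>
     f2 \<cdot>\<^bsub>L\<^esub> r = s \<cdot>\<^bsub>L\<^esub> f1)"

definition reflection_morphism ::
  "('o, 't1, 't2, 'l1, 'l2) fcat \<Rightarrow> 'l1 \<Rightarrow> 'l1 \<Rightarrow> 'l2 \<Rightarrow> 'l1 \<Rightarrow> 'l1 \<Rightarrow> 'l2 \<Rightarrow> 'l1 \<Rightarrow> 'l1 \<Rightarrow> bool" where
  "reflection_morphism A f1 g1 \<eta>1 f2 g2 \<eta>2 r s \<longleftrightarrow> (let L = loose_cat A in
     tight_square A f1 f2 r s \<and> g2 \<cdot>\<^bsub>L\<^esub> s = r \<cdot>\<^bsub>L\<^esub> g1 \<and>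
     whisker_left L r \<eta>1 = whisker_right L \<eta>2 r)"

definition Refl_at ::
  "bool \<Rightarrow> ('o, 't1, 't2, 'l1, 'l2) fcat \<Rightarrow> ('o2, 't1b, 't2b, 'l1b, 'l2b) fcat
    \<Rightarrow> ('o, 'l1, 'l2, 'o2, 'l1b, 'l2b) twofun \<Rightarrow> bool" where
  "Refl_at p A B H \<longleftrightarrow>
     (\<forall>f\<in>Tight A. \<forall>g \<eta>. reflection p B (F1 H f) g \<eta> \<longrightarrow>
        (\<exists>!(g', \<eta>'). reflection p A f g' \<eta>' \<and> F1 H g' = g \<and> F2 H \<eta>' = \<eta>))"

definition Morph_at ::
  "bool \<Rightarrow> ('o, 't1, 't2, 'l1, 'l2) fcat \<Rightarrow> ('o2, 't1b, 't2b, 'l1b, 'l2b) fcat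
    \<Rightarrow> ('o, 'l1, 'l2, 'o2, 'l1b, 'l2b) twofun \<Rightarrow> bool" where
  "Morph_at p A B H \<longleftrightarrow>
     (\<forall>f1 g1 \<eta>1 f2 g2 \<eta>2 r s.
        reflection p A f1 g1 \<eta>1 \<longrightarrow> reflection p A f2 g2 \<eta>2 \<longrightarrow> tight_square A f1 f2 r s \<longrightarrow>
        (reflection_morphism A f1 g1 \<eta>1 f2 g2 \<eta>2 r s \<longleftrightarrow>
         reflection_morphism B (F1 H f1) (F1 H g1) (F2 H \<eta>1) (F1 H f2) (F1 H g2) (F2 H \<eta>2)
           (F1 H r) (F1 H s)))"

primrec satisfies_Refl ::
  "flavour \<Rightarrow> ('o, 't1, 't2, 'l1, 'l2) fcat \<Rightarrow> ('o2, 't1b, 't2b, 'l1b, 'l2b) fcat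
    \<Rightarrow> ('o, 'l1, 'l2, 'o2, 'l1b, 'l2b) twofun \<Rightarrow> bool" where
  "satisfies_Refl Lax A B H = Refl_at False A B H"
| "satisfies_Refl Pseudo A B H = Refl_at True A B H"
| "satisfies_Refl Colax A B H = Refl_at False (F_co A) (F_co B) H"

primrec satisfies_Morph ::
  "flavour \<Rightarrow> ('o, 't1, 't2, 'l1, 'l2) fcat \<Rightarrow> ('o2, 't1b, 't2b, 'l1b, 'l2b) fcat
    \<Rightarrow> ('o, 'l1, 'l2, 'o2, 'l1b, 'l2b) twofun \<Rightarrow> bool" where
  "satisfies_Morph Lax A B H = Morph_at False A B H"
| "satisfies_Morph Pseudo A B H = Morph_at True A B H"
| "satisfies_Morph Colax A B H = Morph_at False (F_co A) (F_co B) H"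

definition locally_faithful ::
  "('o, 't1, 't2, 'l1, 'l2) fcat \<Rightarrow> ('o, 'l1, 'l2, 'o2, 'l1b, 'l2b) twofun \<Rightarrow> bool" where
  "locally_faithful A H \<longleftrightarrow>
     (\<forall>\<alpha> \<beta> f g. is_cell (loose_cat A) \<alpha> f g \<longrightarrow> is_cell (loose_cat A) \<beta> f g \<longrightarrow>
        F2 H \<alpha> = F2 H \<beta> \<longrightarrow> \<alpha> = \<beta>)"

definition doctrinal ::
  "flavour \<Rightarrow> ('o, 't1, 't2, 'l1, 'l2) fcat \<Rightarrow> ('o2, 't1b, 't2b, 'l1b, 'l2b) fcat
    \<Rightarrow> ('o, 'l1, 'l2, 'o2, 'l1b, 'l2b) twofun \<Rightarrow> bool" where
  "doctrinal w A B H \<longleftrightarrow>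
     F_functor A B H \<and> satisfies_Refl w A B H \<and> satisfies_Morph w A B H \<and> locally_faithful A H"


section \<open>Limits of loose morphisms\<close>

text \<open>
  In this section the boolean \<open>p\<close> selects the pseudo variant, in which the 2-cells of the cones are
  required to be invertible. The tight projections are written \<open>P\<close> and \<open>Q\<close>.
\<close>

definition colax_cone ::
  "bool \<Rightarrow> ('o, 't1, 't2, 'l1, 'l2) fcat \<Rightarrow> 'l1 \<Rightarrow> 'o \<Rightarrow> 'l1 \<Rightarrow> 'l2 \<Rightarrow> 'l1 \<Rightarrow> bool" where
  "colax_cone p A f X r \<alpha> s \<longleftrightarrow> (let L = loose_cat A in
     is_arr L r X (dom1 L f) \<and> is_arr L s X (cod1 L f) \<and> is_cell L \<alpha> s (f \<cdot>\<^bsub>L\<^esub> r) \<and>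
     (p \<longrightarrow> invertible_cell L \<alpha>))"

definition induces ::
  "('o, 't1, 't2, 'l1, 'l2) fcat \<Rightarrow> 'o \<Rightarrow> 'l1 \<Rightarrow> 'l2 \<Rightarrow> 'l1 \<Rightarrow> 'o \<Rightarrow> 'l1 \<Rightarrow> 'l2 \<Rightarrow> 'l1 \<Rightarrow> 'l1 \<Rightarrow> bool" where
  "induces A C P lam Q X r \<alpha> s t \<longleftrightarrow> (let L = loose_cat A in
     is_arr L t X C \<and> P \<cdot>\<^bsub>L\<^esub> t = r \<and> Q \<cdot>\<^bsub>L\<^esub> t = s \<and> whisker_right L lam t = \<alpha>)"

definition colax_limit ::
  "bool \<Rightarrow> ('o, 't1, 't2, 'l1, 'l2) fcat \<Rightarrow> 'l1 \<Rightarrow> 'o \<Rightarrow> 'l1 \<Rightarrow> 'l2 \<Rightarrow> 'l1 \<Rightarrow> bool" where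
  "colax_limit p A f C P lam Q \<longleftrightarrow> (let L = loose_cat A in
     C \<in> Ob L \<and> P \<in> Tight A \<and> Q \<in> Tight A \<and> colax_cone p A f C P lam Q \<and>
     (\<forall>X r \<alpha> s. colax_cone p A f X r \<alpha> s \<longrightarrow> (\<exists>!t. induces A C P lam Q X r \<alpha> s t)) \<and>
     (\<forall>X r \<alpha> s t r' \<alpha>' s' t' \<theta>r \<theta>s.
        colax_cone p A f X r \<alpha> s \<longrightarrow> induces A C P lam Q X r \<alpha> s t \<longrightarrow>
        colax_cone p A f X r' \<alpha>' s' \<longrightarrow> induces A C P lam Q X r' \<alpha>' s' t' \<longrightarrow>
        is_cell L \<theta>r r r' \<longrightarrow> is_cell L \<theta>s s s' \<longrightarrow>
        \<alpha>' \<bullet>\<^bsub>L\<^esub> \<theta>s = whisker_left L f \<theta>r \<bullet>\<^bsub>L\<^esub> \<alpha> \<longrightarrow>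
        (\<exists>!\<phi>. is_cell L \<phi> t t' \<and> whisker_left L P \<phi> = \<theta>r \<and> whisker_left L Q \<phi> = \<theta>s)) \<and>
     (\<forall>X t. is_arr L t X C \<longrightarrow>
        (t \<in> Tight A \<longleftrightarrow> P \<cdot>\<^bsub>L\<^esub> t \<in> Tight A \<and> Q \<cdot>\<^bsub>L\<^esub> t \<in> Tight A)))"

primrec limit_of_loose ::
  "flavour \<Rightarrow> ('o, 't1, 't2, 'l1, 'l2) fcat \<Rightarrow> 'l1 \<Rightarrow> 'o \<Rightarrow> 'l1 \<Rightarrow> 'l2 \<Rightarrow> 'l1 \<Rightarrow> bool" where
  "limit_of_loose Colax A f C P lam Q = colax_limit False A f C P lam Q"
| "limit_of_loose Pseudo A f C P lam Q = colax_limit True A f C P lam Q"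
| "limit_of_loose Lax A f C P lam Q = colax_limit False (F_co A) f C P lam Q"

definition admits_limits_of_loose ::
  "flavour \<Rightarrow> ('o, 't1, 't2, 'l1, 'l2) fcat \<Rightarrow> bool" where
  "admits_limits_of_loose w A \<longleftrightarrow>
     (\<forall>f\<in>Arr (loose_cat A). \<exists>C P lam Q. limit_of_loose w A f C P lam Q)"

end

theory Submission
  imports Defs
begin

text \<open>
  Every loose morphism \<open>f : x \<leadsto> y\<close> of \<open>\<bbbA>\<close> can be rebuilt from tight morphisms and a
  reflection. Let \<open>C\<close> be its limit, with tight projections \<open>P : C \<rightarrow> x\<close> and \<open>Q : C \<rightarrow> y\<close>.
  The identity cone over \<open>f\<close> induces a section \<open>r\<close> of \<open>P\<close> with \<open>f = Q r\<close>, and the two-dimensional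
  universal property makes \<open>r\<close> right adjoint to \<open>P\<close> with identity counit
  (\<open>projection_reflection\<close>). The square forces \<open>H R P = S P\<close>, so the reflection \<open>S P \<stileturn> S r\<close>
  lifts along \<open>H\<close> to a reflection \<open>R P \<stileturn> r'\<close>, and a filler \<open>K\<close> has no choice but to send \<open>r\<close> to \<open>r'\<close>
  and \<open>f\<close> to \<open>R Q \<cdot> r'\<close>. This gives uniqueness, and it defines \<open>K\<close> on 1-cells.

  That \<open>K\<close> is functorial rests on one comparison. Let \<open>f' \<stileturn> r\<^sub>1\<close> be any reflection, \<open>q\<close> and \<open>s\<close>
  tight, and \<open>q r\<^sub>1 = f s\<close>. Then \<open>s f'\<close> and \<open>q\<close> are the legs of a cone over \<open>f\<close>, and the tight
  morphism which this cone induces is a morphism of reflections from \<open>f' \<stileturn> r\<^sub>1\<close> to \<open>P \<stileturn> r\<close>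
  (\<open>universal_reflection_morphism\<close>). By the condition on morphisms of reflections its image in \<open>\<bbbB>\<close>
  is one between the lifted reflections, whence \<open>R q \<cdot> r\<^sub>1' = K f \<cdot> R s\<close> (\<open>K1_square\<close>). Call
  \<open>f = q r\<^sub>1\<close> a presentation of \<open>f\<close> if \<open>q\<close> is tight and \<open>r\<^sub>1\<close> is the right adjoint of a reflection: the
  case \<open>s = 1\<close> says that any presentation computes \<open>K f\<close>. The trivial presentation \<open>f = f 1\<close> of a
  tight \<open>f\<close> shows that \<open>K\<close> extends \<open>R\<close>; to compare \<open>K (g f)\<close> with \<open>K g \<cdot> K f\<close> one presents \<open>f = q r\<close>
  and then \<open>g q = q\<^sub>2 r\<^sub>2\<close>, and composes the two reflections.

  On 2-cells only existence is at stake: since \<open>H\<close> is locally faithful, a 2-cell of \<open>\<bbbB>\<close> with given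
  boundary and given image in \<open>\<bbbC>\<close> is unique, and all equations between 2-cells can be checked after
  applying \<open>H\<close>. A 2-cell \<open>\<alpha> : f \<Rightarrow> g\<close> of \<open>\<bbbA>\<close> has to be built from tight data. In the lax case, pasting
  \<open>\<alpha>\<close> to a presentation of \<open>f\<close> gives a cone over \<open>g\<close>, and \<open>\<alpha>\<close> is a whiskering of the unit of the
  reflection belonging to \<open>g\<close>. In the pseudo case such a cone would have to be invertible, so instead
  \<open>f\<close> and \<open>g\<close> are presented over one and the same reflection, \<open>f = q\<^sub>1 r\<close> and \<open>g = q\<^sub>2 r\<close>; invertibility
  of the unit then extends \<open>\<alpha>\<close> to a 2-cell \<open>q\<^sub>1 \<Rightarrow> q\<^sub>2\<close> between tight morphisms. The colax case is the lax
  case for the duals obtained by reversing 2-cells.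
\<close>

section \<open>Calculus of whiskering\<close>

notation whisker_left (infixr "\<lhd>\<index>" 75)
notation whisker_right (infixr "\<rhd>\<index>" 75)

lemma is_arrE:
  assumes "is_arr A f x y"
  shows "f \<in> Arr A" "dom1 A f = x" "cod1 A f = y"
  using assms by (auto simp: is_arr_def)

lemma is_cellE:
  assumes "is_cell A \<alpha> f g"
  shows "\<alpha> \<in> Cell A" "src A \<alpha> = f" "trg A \<alpha> = g"
  using assms by (auto simp: is_cell_def)

lemma is_arrI: "f \<in> Arr A \<Longrightarrow> is_arr A f (dom1 A f) (cod1 A f)"
  by (simp add: is_arr_def)

lemma is_cellI: "\<alpha> \<in> Cell A \<Longrightarrow> is_cell A \<alpha> (src A \<alpha>) (trg A \<alpha>)"
  by (simp add: is_cell_def)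

context two_category
begin

lemma ob_arr: "is_arr A f x y \<Longrightarrow> x \<in> Ob A" "is_arr A f x y \<Longrightarrow> y \<in> Ob A"
  using dom_in cod_in by (auto simp: is_arr_def)

lemma cell_trg: "is_cell A \<alpha> f g \<Longrightarrow> is_arr A f x y \<Longrightarrow> is_arr A g x y"
  using src_trg_parallel by (auto simp: is_cell_def is_arr_def parallel1_def)

lemma cell_arr: "is_cell A \<alpha> f g \<Longrightarrow> is_arr A f (dom1 A f) (cod1 A f)"
  using src_trg_parallel by (auto simp: is_cell_def is_arr_def parallel1_def)

lemma id2_cell': "is_arr A f x y \<Longrightarrow> is_cell A (id2 A f) f f"
  using id2_cell by (auto simp: is_arr_def)

lemma whisker_left_cell:
  "\<lbrakk>is_cell A \<theta> g g'; is_arr A g x y; is_arr A f y z\<rbrakk> \<Longrightarrow> is_cell A (f \<lhd> \<theta>) (f \<cdot> g) (f \<cdot> g')"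
  unfolding whisker_left_def using hcomp_cell[of \<theta> g g' "id2 A f" f f] id2_cell[of f]
  by (auto simp: is_arr_def)

lemma whisker_right_cell:
  "\<lbrakk>is_cell A \<theta> g g'; is_arr A g y z; is_arr A f x y\<rbrakk> \<Longrightarrow> is_cell A (\<theta> \<rhd> f) (g \<cdot> f) (g' \<cdot> f)"
  unfolding whisker_right_def using hcomp_cell[of "id2 A f" f f \<theta> g g'] id2_cell[of f]
  by (auto simp: is_arr_def)

lemma whisker_left_comp:
  "\<lbrakk>is_cell A \<theta> h h'; is_arr A h w x; is_arr A g x y; is_arr A f y z\<rbrakk> \<Longrightarrow> f \<lhd> (g \<lhd> \<theta>) = (f \<cdot> g) \<lhd> \<theta>"
  unfolding whisker_left_def
  using hcomp_assoc[of \<theta> h h' "id2 A g" g g "id2 A f" f f] hcomp_id2[of g x y f z] id2_cell[of f] id2_cell[of g]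
  by (auto simp: is_arr_def)

lemma whisker_right_comp:
  "\<lbrakk>is_cell A \<theta> h h'; is_arr A h y z; is_arr A g x y; is_arr A f w x\<rbrakk> \<Longrightarrow> (\<theta> \<rhd> g) \<rhd> f = \<theta> \<rhd> (g \<cdot> f)"
  unfolding whisker_right_def
  using hcomp_assoc[of "id2 A f" f f "id2 A g" g g \<theta> h h'] hcomp_id2[of f w x g y] id2_cell[of f] id2_cell[of g]
  by (auto simp: is_arr_def)

lemma whisker_left_right:
  "\<lbrakk>is_cell A \<theta> g g'; is_arr A g x y; is_arr A f w x; is_arr A h y z\<rbrakk> \<Longrightarrow> h \<lhd> (\<theta> \<rhd> f) = (h \<lhd> \<theta>) \<rhd> f"
  unfolding whisker_right_def whisker_left_def
  using hcomp_assoc[of "id2 A f" f f \<theta> g g' "id2 A h" h h] id2_cell[of f] id2_cell[of h]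
  by (auto simp: is_arr_def)

lemma whisker_left_id2: "\<lbrakk>is_arr A g x y; is_arr A f y z\<rbrakk> \<Longrightarrow> f \<lhd> id2 A g = id2 A (f \<cdot> g)"
  unfolding whisker_left_def by (rule hcomp_id2)

lemma whisker_right_id2: "\<lbrakk>is_arr A g x y; is_arr A f y z\<rbrakk> \<Longrightarrow> id2 A f \<rhd> g = id2 A (f \<cdot> g)"
  unfolding whisker_right_def by (rule hcomp_id2)

lemma whisker_left_id1: "\<lbrakk>is_cell A \<theta> f g; is_arr A f x y\<rbrakk> \<Longrightarrow> id1 A y \<lhd> \<theta> = \<theta>"
  unfolding whisker_left_def using hcomp_unit_left by (auto simp: is_arr_def)

lemma whisker_right_id1: "\<lbrakk>is_cell A \<theta> f g; is_arr A f x y\<rbrakk> \<Longrightarrow> \<theta> \<rhd> id1 A x = \<theta>"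
  unfolding whisker_right_def using hcomp_unit_right by (auto simp: is_arr_def)

lemma whisker_left_vcomp:
  "\<lbrakk>is_cell A \<alpha> g g'; is_cell A \<beta> g' g''; is_arr A g x y; is_arr A f y z\<rbrakk>
     \<Longrightarrow> f \<lhd> (\<beta> \<bullet> \<alpha>) = (f \<lhd> \<beta>) \<bullet> (f \<lhd> \<alpha>)"
  unfolding whisker_left_def
  using interchange[of \<alpha> g g' \<beta> g'' "id2 A f" f f "id2 A f" f] id2_cell[of f] id2_left[of "id2 A f" f f]
  by (auto simp: is_arr_def)

lemma whisker_right_vcomp:
  "\<lbrakk>is_cell A \<alpha> g g'; is_cell A \<beta> g' g''; is_arr A g y z; is_arr A f x y\<rbrakk>
     \<Longrightarrow> (\<beta> \<bullet> \<alpha>) \<rhd> f = (\<beta> \<rhd> f) \<bullet> (\<alpha> \<rhd> f)"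
  unfolding whisker_right_def
  using interchange[of "id2 A f" f f "id2 A f" f \<alpha> g g' \<beta> g''] id2_cell[of f] id2_left[of "id2 A f" f f]
  by (auto simp: is_arr_def)

text \<open>
  Both sides are the horizontal composite \<open>\<beta> \<star> \<alpha>\<close>.
\<close>

lemma whisker_interchange:
  assumes "is_cell A \<alpha> f f'" "is_arr A f x y" "is_cell A \<beta> g g'" "is_arr A g y z"
  shows "(\<beta> \<rhd> f') \<bullet> (g \<lhd> \<alpha>) = (g' \<lhd> \<alpha>) \<bullet> (\<beta> \<rhd> f)"
proof -
  have f': "is_arr A f' x y" and g': "is_arr A g' y z" using assms cell_trg by blast+
  have "(\<beta> \<star> id2 A f') \<bullet> (id2 A g \<star> \<alpha>) = (\<beta> \<bullet> id2 A g) \<star> (id2 A f' \<bullet> \<alpha>)"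
    using interchange[of \<alpha> f f' "id2 A f'" f' "id2 A g" g g \<beta> g'] assms f' g' id2_cell
    by (auto simp: is_arr_def)
  also have "\<dots> = (id2 A g' \<bullet> \<beta>) \<star> (\<alpha> \<bullet> id2 A f)"
    using assms by (simp add: id2_left[of _ f f'] id2_left[of _ g g'] id2_right[of _ f f'] id2_right[of _ g g'])
  also have "\<dots> = (id2 A g' \<star> \<alpha>) \<bullet> (\<beta> \<star> id2 A f)"
    using interchange[of "id2 A f" f f \<alpha> f' \<beta> g g' "id2 A g'" g'] assms f' g' id2_cell
    by (auto simp: is_arr_def)
  finally show ?thesis unfolding whisker_left_def whisker_right_def .
qed

lemma invertible_cellE:
  assumes "invertible_cell A \<alpha>" "is_cell A \<alpha> f g"
  obtains \<beta> where "is_cell A \<beta> g f" "\<beta> \<bullet> \<alpha> = id2 A f" "\<alpha> \<bullet> \<beta> = id2 A g"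
  using assms by (auto simp: invertible_cell_def is_cell_def)

lemma invertible_cellI:
  assumes "is_cell A \<alpha> f g" "is_cell A \<beta> g f" "\<beta> \<bullet> \<alpha> = id2 A f" "\<alpha> \<bullet> \<beta> = id2 A g"
  shows "invertible_cell A \<alpha>"
  using assms by (auto simp: invertible_cell_def is_cell_def)

lemma invertible_id2: "is_arr A f x y \<Longrightarrow> invertible_cell A (id2 A f)"
  using invertible_cellI[of "id2 A f" f f "id2 A f"] id2_cell' id2_left by blast

lemma invertible_whisker_left:
  assumes "invertible_cell A \<theta>" "is_cell A \<theta> g g'" "is_arr A g x y" "is_arr A f y z"
  shows "invertible_cell A (f \<lhd> \<theta>)"
proof -
  obtain \<theta>' where t: "is_cell A \<theta>' g' g" "\<theta>' \<bullet> \<theta> = id2 A g" "\<theta> \<bullet> \<theta>' = id2 A g'"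
    using assms by (elim invertible_cellE) auto
  have g': "is_arr A g' x y" using assms cell_trg by blast
  show ?thesis
    by (rule invertible_cellI[of _ "f \<cdot> g" "f \<cdot> g'" "f \<lhd> \<theta>'"])
      (use assms t g' in \<open>simp_all add: whisker_left_cell whisker_left_vcomp[symmetric] whisker_left_id2\<close>)
qed

lemma invertible_whisker_right:
  assumes "invertible_cell A \<theta>" "is_cell A \<theta> g g'" "is_arr A g y z" "is_arr A f x y"
  shows "invertible_cell A (\<theta> \<rhd> f)"
proof -
  obtain \<theta>' where t: "is_cell A \<theta>' g' g" "\<theta>' \<bullet> \<theta> = id2 A g" "\<theta> \<bullet> \<theta>' = id2 A g'"
    using assms by (elim invertible_cellE) auto
  have g': "is_arr A g' y z" using assms cell_trg by blast
  show ?thesis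
    by (rule invertible_cellI[of _ "g \<cdot> f" "g' \<cdot> f" "\<theta>' \<rhd> f"])
      (use assms t g' in \<open>simp_all add: whisker_right_cell whisker_right_vcomp[symmetric] whisker_right_id2\<close>)
qed

lemma invertible_vcomp:
  assumes "invertible_cell A \<alpha>" "is_cell A \<alpha> f g" "invertible_cell A \<beta>" "is_cell A \<beta> g h"
  shows "invertible_cell A (\<beta> \<bullet> \<alpha>)"
proof -
  obtain \<alpha>' where a: "is_cell A \<alpha>' g f" "\<alpha>' \<bullet> \<alpha> = id2 A f" "\<alpha> \<bullet> \<alpha>' = id2 A g"
    using assms by (elim invertible_cellE) auto
  obtain \<beta>' where b: "is_cell A \<beta>' h g" "\<beta>' \<bullet> \<beta> = id2 A g" "\<beta> \<bullet> \<beta>' = id2 A h"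
    using assms by (elim invertible_cellE) auto
  have "(\<alpha>' \<bullet> \<beta>') \<bullet> (\<beta> \<bullet> \<alpha>) = \<alpha>' \<bullet> ((\<beta>' \<bullet> \<beta>) \<bullet> \<alpha>)"
    using vcomp_assoc[OF vcomp_cell[OF assms(2,4)] b(1) a(1)] vcomp_assoc[OF assms(2,4) b(1)] by simp
  then have 1: "(\<alpha>' \<bullet> \<beta>') \<bullet> (\<beta> \<bullet> \<alpha>) = id2 A f"
    using a b id2_left[OF assms(2)] by simp
  have "(\<beta> \<bullet> \<alpha>) \<bullet> (\<alpha>' \<bullet> \<beta>') = \<beta> \<bullet> ((\<alpha> \<bullet> \<alpha>') \<bullet> \<beta>')"
    using vcomp_assoc[OF vcomp_cell[OF b(1) a(1)] assms(2,4)] vcomp_assoc[OF b(1) a(1) assms(2)] by simp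
  then have 2: "(\<beta> \<bullet> \<alpha>) \<bullet> (\<alpha>' \<bullet> \<beta>') = id2 A h"
    using a b id2_left[OF b(1)] by simp
  show ?thesis
    by (rule invertible_cellI[OF vcomp_cell[OF assms(2,4)] vcomp_cell[OF b(1) a(1)] 1 2])
qed

end

section \<open>2-functors preserve the calculus\<close>

locale two_functor_on = dom: two_category A + cod: two_category B
  for A :: "('o, 'a, 'c) twocat" and B :: "('o2, 'a2, 'c2) twocat" +
  fixes F :: "('o, 'a, 'c, 'o2, 'a2, 'c2) twofun"
  assumes functorial: "two_functor A B F"
begin

lemma F_arr: "is_arr A f x y \<Longrightarrow> is_arr B (F1 F f) (F0 F x) (F0 F y)"
  using functorial by (auto simp: two_functor_def is_arr_def)

lemma F_cell: "is_cell A \<alpha> f g \<Longrightarrow> is_cell B (F2 F \<alpha>) (F1 F f) (F1 F g)"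
  using functorial by (auto simp: two_functor_def is_cell_def)

lemma F_id1: "x \<in> Ob A \<Longrightarrow> F1 F (id1 A x) = id1 B (F0 F x)"
  using functorial by (auto simp: two_functor_def)

lemma F_comp1: "is_arr A f x y \<Longrightarrow> is_arr A g y z \<Longrightarrow> F1 F (g \<cdot>\<^bsub>A\<^esub> f) = F1 F g \<cdot>\<^bsub>B\<^esub> F1 F f"
  using functorial by (auto simp: two_functor_def is_arr_def)

lemma F_id2: "is_arr A f x y \<Longrightarrow> F2 F (id2 A f) = id2 B (F1 F f)"
  using functorial by (auto simp: two_functor_def is_arr_def)

lemma F_vcomp: "is_cell A \<alpha> f g \<Longrightarrow> is_cell A \<beta> g h \<Longrightarrow> F2 F (\<beta> \<bullet>\<^bsub>A\<^esub> \<alpha>) = F2 F \<beta> \<bullet>\<^bsub>B\<^esub> F2 F \<alpha>"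
  using functorial by (auto simp: two_functor_def is_cell_def)

lemma F_hcomp:
  "\<lbrakk>is_cell A \<alpha> f f'; is_cell A \<beta> g g'; is_arr A f x y; is_arr A g y z\<rbrakk>
    \<Longrightarrow> F2 F (\<beta> \<star>\<^bsub>A\<^esub> \<alpha>) = F2 F \<beta> \<star>\<^bsub>B\<^esub> F2 F \<alpha>"
  using functorial by (auto simp: two_functor_def is_cell_def is_arr_def)

lemma F_whisker_left:
  "\<lbrakk>is_cell A \<theta> g g'; is_arr A g x y; is_arr A f y z\<rbrakk>
    \<Longrightarrow> F2 F (f \<lhd>\<^bsub>A\<^esub> \<theta>) = F1 F f \<lhd>\<^bsub>B\<^esub> F2 F \<theta>"
  unfolding whisker_left_def using F_hcomp[of \<theta> g g' "id2 A f" f f x y z] dom.id2_cell'[of f y z] F_id2[of f y z] by simp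

lemma F_whisker_right:
  "\<lbrakk>is_cell A \<theta> g g'; is_arr A g y z; is_arr A f x y\<rbrakk>
    \<Longrightarrow> F2 F (\<theta> \<rhd>\<^bsub>A\<^esub> f) = F2 F \<theta> \<rhd>\<^bsub>B\<^esub> F1 F f"
  unfolding whisker_right_def using F_hcomp[of "id2 A f" f f \<theta> g g' x y z] dom.id2_cell'[of f x y] F_id2[of f x y] by simp

lemma F_invertible:
  assumes "invertible_cell A \<alpha>" "is_cell A \<alpha> f g"
  shows "invertible_cell B (F2 F \<alpha>)"
proof -
  obtain \<beta> where b: "is_cell A \<beta> g f" "\<beta> \<bullet>\<^bsub>A\<^esub> \<alpha> = id2 A f" "\<alpha> \<bullet>\<^bsub>A\<^esub> \<beta> = id2 A g"
    using assms by (elim dom.invertible_cellE) auto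
  show ?thesis
    using cod.invertible_cellI[OF F_cell[OF assms(2)] F_cell[OF b(1)]] b
      F_vcomp[OF assms(2) b(1)] F_vcomp[OF b(1) assms(2)]
      F_id2[OF dom.cell_arr[OF assms(2)]] F_id2[OF dom.cell_arr[OF b(1)]] by simp
qed

end

lemma twofun_eqI:
  fixes F G :: "('x0, 'x1, 'x2, 'y0, 'y1, 'y2) twofun"
  assumes "F0 F \<in> extensional X0" "F1 F \<in> extensional X1" "F2 F \<in> extensional X2"
    "F0 G \<in> extensional X0" "F1 G \<in> extensional X1" "F2 G \<in> extensional X2"
    "\<And>x. x \<in> X0 \<Longrightarrow> F0 F x = F0 G x" "\<And>f. f \<in> X1 \<Longrightarrow> F1 F f = F1 G f"
    "\<And>\<alpha>. \<alpha> \<in> X2 \<Longrightarrow> F2 F \<alpha> = F2 G \<alpha>"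
  shows "F = G"
proof -
  have "F0 F = F0 G" by (rule extensionalityI[OF assms(1,4,7)])
  moreover have "F1 F = F1 G" by (rule extensionalityI[OF assms(2,5,8)])
  moreover have "F2 F = F2 G" by (rule extensionalityI[OF assms(3,6,9)])
  ultimately show ?thesis by (cases F; cases G) simp
qed

lemma two_functor_extensional:
  assumes "two_functor X Y F"
  shows "F0 F \<in> extensional (Ob X)" "F1 F \<in> extensional (Arr X)" "F2 F \<in> extensional (Cell X)"
  using assms unfolding two_functor_def by (auto simp: PiE_def)

lemma F_comp_extensional:
  "F0 (F_comp X G F) \<in> extensional (Ob (loose_cat X))"
  "F1 (F_comp X G F) \<in> extensional (Arr (loose_cat X))"
  "F2 (F_comp X G F) \<in> extensional (Cell (loose_cat X))"
  by (simp_all add: F_comp_def two_comp_def)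

lemma F_comp_apply:
  "x \<in> Ob (loose_cat X) \<Longrightarrow> F0 (F_comp X G F) x = F0 G (F0 F x)"
  "f \<in> Arr (loose_cat X) \<Longrightarrow> F1 (F_comp X G F) f = F1 G (F1 F f)"
  "\<alpha> \<in> Cell (loose_cat X) \<Longrightarrow> F2 (F_comp X G F) \<alpha> = F2 G (F2 F \<alpha>)"
  by (simp_all add: F_comp_def two_comp_def compose_def)

section \<open>Reflections\<close>

text \<open>
  The loose 2-category gets a name of its own, so that it can serve as the implicit structure of the
  notation for composition.
\<close>

locale F_cat =
  fixes A :: "('o, 't1, 't2, 'l1, 'l2) fcat" and L :: "('o, 'l1, 'l2) twocat" (structure)
  assumes F_category: "F_category A" and L_eq: "loose_cat A = L"
begin

sublocale two_category L
  using F_category by (simp add: F_category_def L_eq)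

sublocale incl: two_functor_on "tight_cat A" L "incl A"
  using F_category by (simp add: F_category_def L_eq two_functor_on_def two_functor_on_axioms_def)

lemma Ob_tight: "Ob (tight_cat A) = Ob L"
  and F0_incl: "x \<in> Ob L \<Longrightarrow> F0 (incl A) x = x"
  using F_category by (simp_all add: F_category_def L_eq)

lemma tight_preimage:
  assumes "f \<in> Tight A" "is_arr L f x y"
  obtains g where "is_arr (tight_cat A) g x y" "F1 (incl A) g = f"
proof -
  obtain g where g: "g \<in> Arr (tight_cat A)" "F1 (incl A) g = f"
    using assms(1) by (auto simp: Tight_def)
  from incl.F_arr[OF is_arrI[OF g(1)]] incl.dom.ob_arr[OF is_arrI[OF g(1)]] g assms(2)
  have "is_arr (tight_cat A) g x y"
    by (auto simp: is_arr_def F0_incl Ob_tight)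
  then show thesis using g(2) that by blast
qed

lemma incl_arr: "is_arr (tight_cat A) f x y \<Longrightarrow> is_arr L (F1 (incl A) f) x y"
  using incl.F_arr[of f x y] incl.dom.ob_arr[of f x y] by (simp add: F0_incl Ob_tight)

lemma incl_tight: "is_arr (tight_cat A) f x y \<Longrightarrow> F1 (incl A) f \<in> Tight A"
  by (auto simp: Tight_def is_arr_def)

lemma tight_id1: "x \<in> Ob L \<Longrightarrow> id1 L x \<in> Tight A"
  using incl.F_id1[of x] incl_tight[OF incl.dom.id1_arr[of x]] by (simp add: F0_incl Ob_tight)

lemma tight_comp1:
  assumes "f \<in> Tight A" "g \<in> Tight A" "is_arr L f x y" "is_arr L g y z"
  shows "g \<cdot> f \<in> Tight A"
proof -
  obtain f' where f': "is_arr (tight_cat A) f' x y" "F1 (incl A) f' = f"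
    using tight_preimage[OF assms(1,3)] .
  obtain g' where g': "is_arr (tight_cat A) g' y z" "F1 (incl A) g' = g"
    using tight_preimage[OF assms(2,4)] .
  show ?thesis
    using incl.F_comp1[OF f'(1) g'(1)] incl_tight[OF incl.dom.comp1_arr[OF f'(1) g'(1)]] f' g' by simp
qed

text \<open>
  Since the counit is an identity, the triangle identities reduce to \<open>f \<eta> = 1\<close> and \<open>\<eta> g = 1\<close>. All
  later computations use reflections through this form.
\<close>

lemma reflectionD:
  assumes "reflection p A f g \<eta>" "is_arr L f x y"
  shows "f \<in> Tight A" "is_arr L g y x" "f \<cdot> g = id1 L y" "is_cell L \<eta> (id1 L x) (g \<cdot> f)"
    "f \<lhd> \<eta> = id2 L f" "\<eta> \<rhd> g = id2 L g" "p \<Longrightarrow> invertible_cell L \<eta>"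
proof -
  let ?\<epsilon> = "id2 L (id1 L y)"
  have y: "is_arr L (id1 L y) y y" using assms(2) id1_arr ob_arr by blast
  have cod: "cod1 L f = y" using is_arrE(3)[OF assms(2)] .
  have adj: "adjunction L ?\<epsilon> f g \<eta>" and "f \<in> Tight A" "p \<Longrightarrow> invertible_cell L \<eta>"
    using assms(1) by (auto simp: reflection_def L_eq Let_def cod)
  then show "f \<in> Tight A" "p \<Longrightarrow> invertible_cell L \<eta>" by blast+
  show g: "is_arr L g y x"
    and \<eta>: "is_cell L \<eta> (id1 L x) (g \<cdot> f)"
    using adj assms(2) by (auto simp: adjunction_def is_arr_def)
  have "is_cell L ?\<epsilon> (f \<cdot> g) (id1 L y)"
    using adj assms(2) by (auto simp: adjunction_def is_arr_def)
  then show fg: "f \<cdot> g = id1 L y"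
    using is_cellE(2)[of L ?\<epsilon>] is_cellE(2)[OF id2_cell'[OF y]] by metis
  have x: "is_arr L (id1 L x) x x" using assms(2) id1_arr ob_arr by blast
  have "is_cell L (f \<lhd> \<eta>) (f \<cdot> id1 L x) (f \<cdot> (g \<cdot> f))"
    using whisker_left_cell[OF \<eta> x assms(2)] .
  then have fe: "is_cell L (f \<lhd> \<eta>) f f"
    using id1_right[OF assms(2)] id1_left[OF assms(2)] comp1_assoc[OF assms(2) g assms(2), symmetric] fg by simp
  have "is_cell L (\<eta> \<rhd> g) (id1 L x \<cdot> g) ((g \<cdot> f) \<cdot> g)"
    using whisker_right_cell[OF \<eta> x g] .
  then have eg: "is_cell L (\<eta> \<rhd> g) g g"
    using id1_right[OF g] id1_left[OF g] comp1_assoc[OF g assms(2) g] by (simp add: fg)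
  have "?\<epsilon> \<rhd> f = id2 L f" "g \<lhd> ?\<epsilon> = id2 L g"
    by (simp_all only: whisker_right_id2[OF assms(2) y] whisker_left_id2[OF y g] id1_left[OF assms(2)] id1_right[OF g])
  then have "id2 L f \<bullet> (f \<lhd> \<eta>) = id2 L f" "id2 L g \<bullet> (\<eta> \<rhd> g) = id2 L g"
    using adj unfolding adjunction_def by metis+
  then show "f \<lhd> \<eta> = id2 L f" "\<eta> \<rhd> g = id2 L g"
    by (simp_all only: id2_left[OF fe] id2_left[OF eg])
qed

lemma reflectionI:
  assumes "f \<in> Tight A" "is_arr L f x y" "is_arr L g y x" "f \<cdot> g = id1 L y"
    "is_cell L \<eta> (id1 L x) (g \<cdot> f)"
    "f \<lhd> \<eta> = id2 L f" "\<eta> \<rhd> g = id2 L g" "p \<Longrightarrow> invertible_cell L \<eta>"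
  shows "reflection p A f g \<eta>"
proof -
  have y: "is_arr L (id1 L y) y y" using assms(2) id1_arr ob_arr by blast
  have cod: "cod1 L f = y" using is_arrE(3)[OF assms(2)] .
  have "id2 L (id1 L y) \<rhd> f = id2 L f" "g \<lhd> id2 L (id1 L y) = id2 L g"
    using whisker_right_id2[OF assms(2) y] whisker_left_id2[OF y assms(3)]
       id1_left[OF assms(2)] id1_right[OF assms(3)] by simp_all
  then show ?thesis
    using assms id2_cell'[OF y] id2_left[OF id2_cell'[OF assms(2)]] id2_left[OF id2_cell'[OF assms(3)]]
    unfolding reflection_def L_eq Let_def cod adjunction_def by auto
qed

lemma reflection_arr:
  assumes "reflection p A f g \<eta>"
  shows "is_arr L f (dom1 L f) (cod1 L f)"
  using assms by (auto simp: reflection_def L_eq Let_def adjunction_def is_arr_def)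

lemma reflection_id1: "x \<in> Ob L \<Longrightarrow> reflection p A (id1 L x) (id1 L x) (id2 L (id1 L x))"
proof -
  assume "x \<in> Ob L"
  note x = id1_arr[OF this] and t = tight_id1[OF this]
  show ?thesis
    using reflectionI[OF t x x, of "id2 L (id1 L x)" p] id1_left[OF x] id2_cell'[OF x]
      whisker_left_id2[OF x x] whisker_right_id2[OF x x] invertible_id2[OF x] by simp
qed

lemma reflection_comp:
  assumes 1: "reflection p A f\<^sub>1 g\<^sub>1 \<eta>\<^sub>1" "is_arr L f\<^sub>1 x y"
    and 2: "reflection p A f\<^sub>2 g\<^sub>2 \<eta>\<^sub>2" "is_arr L f\<^sub>2 y z"
  shows "reflection p A (f\<^sub>2 \<cdot> f\<^sub>1) (g\<^sub>1 \<cdot> g\<^sub>2) ((g\<^sub>1 \<lhd> \<eta>\<^sub>2 \<rhd> f\<^sub>1) \<bullet> \<eta>\<^sub>1)"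
proof -
  note D1 = reflectionD[OF 1] and D2 = reflectionD[OF 2]
  note g1 = D1(2) and g2 = D2(2)
  have x: "is_arr L (id1 L x) x x" and y: "is_arr L (id1 L y) y y"
    using 1(2) id1_arr ob_arr by blast+
  have gf2: "is_arr L (g\<^sub>2 \<cdot> f\<^sub>2) y y" using comp1_arr 2 g2 by blast
  have fg: "f\<^sub>1 \<cdot> (g\<^sub>1 \<cdot> h) = h" if "is_arr L h w y" for h w
    using comp1_assoc[OF that g1 1(2), symmetric] id1_left[OF that] D1(3) by simp
  have c1: "is_cell L (\<eta>\<^sub>2 \<rhd> f\<^sub>1) f\<^sub>1 ((g\<^sub>2 \<cdot> f\<^sub>2) \<cdot> f\<^sub>1)"
    using whisker_right_cell[OF D2(4) y 1(2)] id1_left[OF 1(2)] by simp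
  have c2: "is_cell L (g\<^sub>1 \<lhd> \<eta>\<^sub>2 \<rhd> f\<^sub>1) (g\<^sub>1 \<cdot> f\<^sub>1) (g\<^sub>1 \<cdot> (g\<^sub>2 \<cdot> f\<^sub>2) \<cdot> f\<^sub>1)"
    using whisker_left_cell[OF c1 1(2) g1] .
  have f21: "is_arr L (f\<^sub>2 \<cdot> f\<^sub>1) x z" and g12: "is_arr L (g\<^sub>1 \<cdot> g\<^sub>2) z x" and gf1: "is_arr L (g\<^sub>1 \<cdot> f\<^sub>1) x x"
    using comp1_arr 1(2) 2(2) g1 g2 by blast+
  have eq: "g\<^sub>1 \<cdot> (g\<^sub>2 \<cdot> f\<^sub>2) \<cdot> f\<^sub>1 = (g\<^sub>1 \<cdot> g\<^sub>2) \<cdot> (f\<^sub>2 \<cdot> f\<^sub>1)"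
    using comp1_assoc[OF f21 g2 g1] comp1_assoc[OF 1(2) 2(2) g2] by simp
  have c3: "is_cell L ((g\<^sub>1 \<lhd> \<eta>\<^sub>2 \<rhd> f\<^sub>1) \<bullet> \<eta>\<^sub>1) (id1 L x) ((g\<^sub>1 \<cdot> g\<^sub>2) \<cdot> (f\<^sub>2 \<cdot> f\<^sub>1))"
    using vcomp_cell[OF D1(4) c2] eq by simp
  have f1e: "f\<^sub>1 \<lhd> (g\<^sub>1 \<lhd> \<eta>\<^sub>2 \<rhd> f\<^sub>1) = \<eta>\<^sub>2 \<rhd> f\<^sub>1"
    using whisker_left_comp[OF c1 1(2) g1 1(2)] whisker_left_id1[OF c1 1(2)] D1(3) by simp
  have "f\<^sub>1 \<lhd> ((g\<^sub>1 \<lhd> \<eta>\<^sub>2 \<rhd> f\<^sub>1) \<bullet> \<eta>\<^sub>1) = (\<eta>\<^sub>2 \<rhd> f\<^sub>1) \<bullet> id2 L f\<^sub>1"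
    using whisker_left_vcomp[OF D1(4) c2 x 1(2)] f1e D1(5) by simp
  then have "f\<^sub>1 \<lhd> ((g\<^sub>1 \<lhd> \<eta>\<^sub>2 \<rhd> f\<^sub>1) \<bullet> \<eta>\<^sub>1) = \<eta>\<^sub>2 \<rhd> f\<^sub>1"
    using id2_right[OF c1] by simp
  then have "(f\<^sub>2 \<cdot> f\<^sub>1) \<lhd> ((g\<^sub>1 \<lhd> \<eta>\<^sub>2 \<rhd> f\<^sub>1) \<bullet> \<eta>\<^sub>1) = f\<^sub>2 \<lhd> (\<eta>\<^sub>2 \<rhd> f\<^sub>1)"
    using whisker_left_comp[OF c3 x 1(2) 2(2)] by simp
  also have "\<dots> = id2 L f\<^sub>2 \<rhd> f\<^sub>1"
    using whisker_left_right[OF D2(4) y 1(2) 2(2)] D2(5) by simp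
  also have "\<dots> = id2 L (f\<^sub>2 \<cdot> f\<^sub>1)"
    using whisker_right_id2 1(2) 2(2) by blast
  finally have left: "(f\<^sub>2 \<cdot> f\<^sub>1) \<lhd> ((g\<^sub>1 \<lhd> \<eta>\<^sub>2 \<rhd> f\<^sub>1) \<bullet> \<eta>\<^sub>1) = id2 L (f\<^sub>2 \<cdot> f\<^sub>1)" .
  have "(g\<^sub>1 \<lhd> \<eta>\<^sub>2 \<rhd> f\<^sub>1) \<rhd> g\<^sub>1 = g\<^sub>1 \<lhd> \<eta>\<^sub>2"
    using whisker_left_right[OF c1 1(2) g1 g1] whisker_right_comp[OF D2(4) y 1(2) g1]
      whisker_right_id1[OF D2(4) y] D1(3) by simp
  moreover have "((g\<^sub>1 \<lhd> \<eta>\<^sub>2 \<rhd> f\<^sub>1) \<bullet> \<eta>\<^sub>1) \<rhd> g\<^sub>1 = ((g\<^sub>1 \<lhd> \<eta>\<^sub>2 \<rhd> f\<^sub>1) \<rhd> g\<^sub>1) \<bullet> id2 L g\<^sub>1"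
    using whisker_right_vcomp[OF D1(4) c2 x g1] D1(6) by simp
  moreover have "is_cell L (g\<^sub>1 \<lhd> \<eta>\<^sub>2) g\<^sub>1 (g\<^sub>1 \<cdot> (g\<^sub>2 \<cdot> f\<^sub>2))"
    using whisker_left_cell[OF D2(4) y g1] id1_right[OF g1] by simp
  ultimately have "((g\<^sub>1 \<lhd> \<eta>\<^sub>2 \<rhd> f\<^sub>1) \<bullet> \<eta>\<^sub>1) \<rhd> g\<^sub>1 = g\<^sub>1 \<lhd> \<eta>\<^sub>2"
    by (simp add: id2_right)
  then have "((g\<^sub>1 \<lhd> \<eta>\<^sub>2 \<rhd> f\<^sub>1) \<bullet> \<eta>\<^sub>1) \<rhd> (g\<^sub>1 \<cdot> g\<^sub>2) = (g\<^sub>1 \<lhd> \<eta>\<^sub>2) \<rhd> g\<^sub>2"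
    using whisker_right_comp[OF c3 x g1 g2] by simp
  also have "\<dots> = g\<^sub>1 \<lhd> id2 L g\<^sub>2"
    using whisker_left_right[OF D2(4) y g2 g1] D2(6) by simp
  also have "\<dots> = id2 L (g\<^sub>1 \<cdot> g\<^sub>2)"
    using whisker_left_id2 g1 g2 by blast
  finally have right: "((g\<^sub>1 \<lhd> \<eta>\<^sub>2 \<rhd> f\<^sub>1) \<bullet> \<eta>\<^sub>1) \<rhd> (g\<^sub>1 \<cdot> g\<^sub>2) = id2 L (g\<^sub>1 \<cdot> g\<^sub>2)" .
  have inv: "invertible_cell L ((g\<^sub>1 \<lhd> \<eta>\<^sub>2 \<rhd> f\<^sub>1) \<bullet> \<eta>\<^sub>1)" if p
    using invertible_vcomp[OF D1(7)[OF that] D1(4) invertible_whisker_left[OF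
       invertible_whisker_right[OF D2(7)[OF that] D2(4) y 1(2)] c1 1(2) g1] c2] .
  have "(f\<^sub>2 \<cdot> f\<^sub>1) \<cdot> (g\<^sub>1 \<cdot> g\<^sub>2) = id1 L z"
    using comp1_assoc[OF g12 1(2) 2(2)] fg[OF g2] D2(3) by simp
  then show ?thesis
    using reflectionI[OF tight_comp1[OF D1(1) D2(1) 1(2) 2(2)] f21 g12 _ c3 left right inv] by simp
qed

text \<open>
  If \<open>\<eta>\<close> is invertible then \<open>q \<cong> q r p\<close> for every \<open>q\<close> out of \<open>X\<close>, so \<open>q\<close> is recovered from its
  restriction along \<open>r\<close>. The extension of \<open>\<alpha>\<close> is \<open>q \<Rightarrow> q r p \<Rightarrow> q' r p \<cong> q'\<close>; it restricts to \<open>\<alpha>\<close>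
  because \<open>\<eta> r\<close> is an identity.
\<close>

lemma pseudo_reflection_cell_extension:
  assumes "reflection True A p r \<eta>" "is_arr L p X x" "is_arr L q X y" "is_arr L q' X y"
    "is_cell L \<alpha> (q \<cdot> r) (q' \<cdot> r)"
  obtains \<beta> where "is_cell L \<beta> q q'" "\<beta> \<rhd> r = \<alpha>"
proof -
  note D = reflectionD[OF assms(1,2)] and r = reflectionD(2)[OF assms(1,2)]
  have X: "is_arr L (id1 L X) X X" using assms(2) id1_arr ob_arr by blast
  have qr: "is_arr L (q \<cdot> r) x y" "is_arr L (q' \<cdot> r) x y"
    using comp1_arr assms r by blast+
  have c: "is_cell L (h \<lhd> \<eta>) h ((h \<cdot> r) \<cdot> p)" if "is_arr L h X y" for h
    using whisker_left_cell[OF D(4) X that] id1_right[OF that] comp1_assoc[OF assms(2) r that] by simp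
  have w: "(h \<lhd> \<eta>) \<rhd> r = id2 L (h \<cdot> r)" if "is_arr L h X y" for h
    using whisker_left_right[OF D(4) X r that] D(6) whisker_left_id2[OF r that] by simp
  obtain \<iota> where i: "is_cell L \<iota> ((q' \<cdot> r) \<cdot> p) q'" "\<iota> \<bullet> (q' \<lhd> \<eta>) = id2 L q'"
    using invertible_cellE[OF invertible_whisker_left[OF D(7) D(4) X assms(4)] c[OF assms(4)]] by blast
  have pr: "((h \<cdot> r) \<cdot> p) \<cdot> r = h \<cdot> r" if "is_arr L h X y" for h
    using comp1_assoc[OF r assms(2) comp1_arr[OF r that]] id1_right[OF comp1_arr[OF r that]] D(3) by simp
  have ir: "is_cell L (\<iota> \<rhd> r) (q' \<cdot> r) (q' \<cdot> r)"
    using whisker_right_cell[OF i(1) comp1_arr[OF assms(2) qr(2)] r] pr[OF assms(4)] by simp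
  have "(\<iota> \<rhd> r) \<bullet> id2 L (q' \<cdot> r) = id2 L (q' \<cdot> r)"
    using whisker_right_vcomp[OF c[OF assms(4)] i(1) assms(4) r] i(2) w[OF assms(4)]
      whisker_right_id2[OF r assms(4)] by simp
  then have ir1: "\<iota> \<rhd> r = id2 L (q' \<cdot> r)"
    using id2_right[OF ir] by simp
  have ap: "is_cell L (\<alpha> \<rhd> p) ((q \<cdot> r) \<cdot> p) ((q' \<cdot> r) \<cdot> p)"
    using whisker_right_cell[OF assms(5) qr(1) assms(2)] .
  have apr: "(\<alpha> \<rhd> p) \<rhd> r = \<alpha>"
    using whisker_right_comp[OF assms(5) qr(1) assms(2) r] D(3) whisker_right_id1[OF assms(5) qr(1)] by simp
  have aq: "is_cell L ((\<alpha> \<rhd> p) \<bullet> (q \<lhd> \<eta>)) q ((q' \<cdot> r) \<cdot> p)"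
    using vcomp_cell[OF c[OF assms(3)] ap] .
  have "((\<alpha> \<rhd> p) \<bullet> (q \<lhd> \<eta>)) \<rhd> r = \<alpha>"
    using whisker_right_vcomp[OF c[OF assms(3)] ap assms(3) r] apr w[OF assms(3)] id2_right[OF assms(5)] by simp
  then have "(\<iota> \<bullet> (\<alpha> \<rhd> p) \<bullet> (q \<lhd> \<eta>)) \<rhd> r = \<alpha>"
    using whisker_right_vcomp[OF aq i(1) assms(3) r] ir1 id2_left[OF assms(5)] by simp
  then show thesis using that vcomp_cell[OF aq i(1)] by blast
qed

end

section \<open>Presenting loose morphisms by reflections\<close>

locale loose_limit = F_cat A L
  for A :: "('o, 't1, 't2, 'l1, 'l2) fcat" and L :: "('o, 'l1, 'l2) twocat" (structure) +
  fixes p :: bool and f C P lam Q and x y :: 'o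
  assumes limit: "colax_limit p A f C P lam Q" and f: "is_arr L f x y"
begin

lemma cone_iff: "colax_cone p A f X r \<alpha> s \<longleftrightarrow>
    is_arr L r X x \<and> is_arr L s X y \<and> is_cell L \<alpha> s (f \<cdot> r) \<and> (p \<longrightarrow> invertible_cell L \<alpha>)"
  using f by (simp add: colax_cone_def L_eq Let_def is_arr_def)

lemma induces_iff: "induces A C P lam Q X r \<alpha> s t \<longleftrightarrow>
    is_arr L t X C \<and> P \<cdot> t = r \<and> Q \<cdot> t = s \<and> lam \<rhd> t = \<alpha>"
  by (simp add: induces_def L_eq Let_def)

lemma projections:
  "P \<in> Tight A" "Q \<in> Tight A" "is_arr L P C x" "is_arr L Q C y"
  "is_cell L lam Q (f \<cdot> P)" "p \<Longrightarrow> invertible_cell L lam" "C \<in> Ob L"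
proof -
  have "colax_cone p A f C P lam Q" "P \<in> Tight A" "Q \<in> Tight A" "C \<in> Ob L"
    using limit unfolding colax_limit_def Let_def L_eq by blast+
  then show "P \<in> Tight A" "Q \<in> Tight A" "is_arr L P C x" "is_arr L Q C y"
    "is_cell L lam Q (f \<cdot> P)" "p \<Longrightarrow> invertible_cell L lam" "C \<in> Ob L"
    unfolding cone_iff by blast+
qed

lemma tight_iff: "is_arr L t X C \<Longrightarrow> t \<in> Tight A \<longleftrightarrow> P \<cdot> t \<in> Tight A \<and> Q \<cdot> t \<in> Tight A"
  using limit by (auto simp: colax_limit_def Let_def L_eq)

lemma factor:
  assumes "is_arr L r X x" "is_arr L s X y" "is_cell L \<alpha> s (f \<cdot> r)" "p \<Longrightarrow> invertible_cell L \<alpha>"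
  obtains t where "is_arr L t X C" "P \<cdot> t = r" "Q \<cdot> t = s" "lam \<rhd> t = \<alpha>"
proof -
  have "colax_cone p A f X r \<alpha> s" using assms by (simp add: cone_iff)
  then have "\<exists>!t. induces A C P lam Q X r \<alpha> s t"
    using limit unfolding colax_limit_def Let_def by blast
  then show thesis using that unfolding induces_iff by blast
qed

lemma cone_of_arr:
  assumes "is_arr L t X C"
  shows "colax_cone p A f X (P \<cdot> t) (lam \<rhd> t) (Q \<cdot> t)"
  using whisker_right_cell[OF projections(5,4) assms] comp1_assoc[OF assms projections(3) f]
    comp1_arr[OF assms projections(3)] comp1_arr[OF assms projections(4)]
    invertible_whisker_right[OF projections(6,5,4) assms]
  by (simp add: cone_iff)

lemma arr_eqI:
  assumes "is_arr L t X C" "is_arr L t' X C" "P \<cdot> t = P \<cdot> t'" "Q \<cdot> t = Q \<cdot> t'" "lam \<rhd> t = lam \<rhd> t'"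
  shows "t = t'"
proof -
  have "\<exists>!u. induces A C P lam Q X (P \<cdot> t) (lam \<rhd> t) (Q \<cdot> t) u"
    using limit cone_of_arr[OF assms(1)] unfolding colax_limit_def Let_def by blast
  then show ?thesis using assms unfolding induces_iff by auto
qed

lemma cell_factor:
  assumes "is_arr L t X C" "is_arr L t' X C"
    "is_cell L \<theta>r (P \<cdot> t) (P \<cdot> t')" "is_cell L \<theta>s (Q \<cdot> t) (Q \<cdot> t')"
    "(lam \<rhd> t') \<bullet> \<theta>s = (f \<lhd> \<theta>r) \<bullet> (lam \<rhd> t)"
  shows "\<exists>!\<phi>. is_cell L \<phi> t t' \<and> P \<lhd> \<phi> = \<theta>r \<and> Q \<lhd> \<phi> = \<theta>s"
proof -
  have "\<forall>X r \<alpha> s t r' \<alpha>' s' t' \<theta>r \<theta>s.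
        colax_cone p A f X r \<alpha> s \<longrightarrow> induces A C P lam Q X r \<alpha> s t \<longrightarrow>
        colax_cone p A f X r' \<alpha>' s' \<longrightarrow> induces A C P lam Q X r' \<alpha>' s' t' \<longrightarrow>
        is_cell L \<theta>r r r' \<longrightarrow> is_cell L \<theta>s s s' \<longrightarrow>
        \<alpha>' \<bullet> \<theta>s = (f \<lhd> \<theta>r) \<bullet> \<alpha> \<longrightarrow>
        (\<exists>!\<phi>. is_cell L \<phi> t t' \<and> P \<lhd> \<phi> = \<theta>r \<and> Q \<lhd> \<phi> = \<theta>s)"
    using limit unfolding colax_limit_def Let_def L_eq by (elim conjE)
  then show ?thesis
    using cone_of_arr[OF assms(1)] cone_of_arr[OF assms(2)] assms unfolding induces_iff by blast
qed

text \<open>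
  The compatibility condition of the two-dimensional universal property holds automatically for
  \<open>P \<phi>\<close> and \<open>Q \<phi>\<close>, by interchange; hence the projections are jointly faithful on 2-cells.
\<close>

lemma cell_eqI:
  assumes "is_arr L t X C" "is_cell L \<phi> t t'" "is_cell L \<phi>' t t'"
    "P \<lhd> \<phi> = P \<lhd> \<phi>'" "Q \<lhd> \<phi> = Q \<lhd> \<phi>'"
  shows "\<phi> = \<phi>'"
proof -
  have t': "is_arr L t' X C" using cell_trg assms by blast
  have "(lam \<rhd> t') \<bullet> (Q \<lhd> \<phi>) = (f \<lhd> (P \<lhd> \<phi>)) \<bullet> (lam \<rhd> t)"
    using whisker_interchange[OF assms(2,1) projections(5,4)]
      whisker_left_comp[OF assms(2,1) projections(3) f] by simp
  from cell_factor[OF assms(1) t' whisker_left_cell[OF assms(2,1) projections(3)]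
       whisker_left_cell[OF assms(2,1) projections(4)] this]
  show ?thesis using assms by auto
qed

text \<open>
  The section \<open>r\<close> is induced by the cone \<open>(1, 1\<^sub>f, f)\<close>. The unit \<open>1 \<Rightarrow> r P\<close> is the 2-cell of cones with
  components \<open>1\<^sub>P\<close> and \<open>lam\<close>, and an inverse of \<open>lam\<close> gives an inverse of the unit in the same way.
\<close>

lemma projection_reflection:
  obtains r \<eta> where "reflection p A P r \<eta>" "Q \<cdot> r = f" "Q \<lhd> \<eta> = lam"
proof -
  note pr = projections
  have X: "is_arr L (id1 L C) C C" and x: "is_arr L (id1 L x) x x"
    using pr(3) id1_arr ob_arr by blast+
  obtain r where r: "is_arr L r x C" "P \<cdot> r = id1 L x" "Q \<cdot> r = f" "lam \<rhd> r = id2 L f"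
    using factor[OF x f, of "id2 L f"] id2_cell'[OF f] id1_right[OF f] invertible_id2[OF f] by auto
  have rP: "is_arr L (r \<cdot> P) C C" and fP: "is_arr L (f \<cdot> P) C y"
    using comp1_arr pr r f by blast+
  have PrP: "P \<cdot> r \<cdot> P = P" and QrP: "Q \<cdot> r \<cdot> P = f \<cdot> P"
    using comp1_assoc[OF pr(3) r(1) pr(3), symmetric] comp1_assoc[OF pr(3) r(1) pr(4), symmetric] r id1_left[OF pr(3)] by simp_all
  have P1: "P \<cdot> id1 L C = P" and Q1: "Q \<cdot> id1 L C = Q" using id1_right pr by blast+
  have lamrP: "lam \<rhd> (r \<cdot> P) = id2 L (f \<cdot> P)"
    using whisker_right_comp[OF pr(5,4) r(1) pr(3)] r(4) whisker_right_id2[OF pr(3) f] by simp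
  have lam1: "lam \<rhd> id1 L C = lam" using whisker_right_id1[OF pr(5,4)] .
  have idP: "is_cell L (id2 L P) P P" using id2_cell' pr by blast
  have fid: "f \<lhd> id2 L P = id2 L (f \<cdot> P)" using whisker_left_id2 pr f by blast
  obtain \<eta> where \<eta>: "is_cell L \<eta> (id1 L C) (r \<cdot> P)" "P \<lhd> \<eta> = id2 L P" "Q \<lhd> \<eta> = lam"
    using cell_factor[OF X rP, of "id2 L P" lam] PrP QrP P1 Q1 idP pr(5) lamrP lam1 fid by auto
  have "is_cell L (\<eta> \<rhd> r) (id1 L C \<cdot> r) ((r \<cdot> P) \<cdot> r)"
    using whisker_right_cell[OF \<eta>(1) X r(1)] .
  then have er: "is_cell L (\<eta> \<rhd> r) r r"
    using comp1_assoc[OF r(1) pr(3) r(1)] r(2) id1_left[OF r(1)] id1_right[OF r(1)] by simp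
  have "\<eta> \<rhd> r = id2 L r"
  proof (rule cell_eqI[OF r(1) er id2_cell'[OF r(1)]])
    show "P \<lhd> \<eta> \<rhd> r = P \<lhd> id2 L r"
      using whisker_left_right[OF \<eta>(1) X r(1) pr(3)] \<eta>(2) whisker_right_id2[OF r(1) pr(3)]
         whisker_left_id2[OF r(1) pr(3)] by simp
    show "Q \<lhd> \<eta> \<rhd> r = Q \<lhd> id2 L r"
      using whisker_left_right[OF \<eta>(1) X r(1) pr(4)] \<eta>(3) r
         whisker_left_id2[OF r(1) pr(4)] by simp
  qed
  moreover have "invertible_cell L \<eta>" if pseudo: p
  proof -
    obtain \<mu> where m: "is_cell L \<mu> (f \<cdot> P) Q" "\<mu> \<bullet> lam = id2 L Q" "lam \<bullet> \<mu> = id2 L (f \<cdot> P)"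
      using invertible_cellE[OF pr(6)[OF pseudo] pr(5)] by blast
    obtain \<zeta> where z: "is_cell L \<zeta> (r \<cdot> P) (id1 L C)" "P \<lhd> \<zeta> = id2 L P" "Q \<lhd> \<zeta> = \<mu>"
      using cell_factor[OF rP X, of "id2 L P" \<mu>] PrP QrP P1 Q1 idP m lamrP lam1 fid
        id2_left[OF id2_cell'[OF fP]] by auto
    have PP: "id2 L P \<bullet> id2 L P = id2 L P" using id2_left[OF idP] .
    have "\<zeta> \<bullet> \<eta> = id2 L (id1 L C)"
      by (rule cell_eqI[OF X vcomp_cell[OF \<eta>(1) z(1)] id2_cell'[OF X]])
        (simp_all add: whisker_left_vcomp[OF \<eta>(1) z(1) X pr(3)] whisker_left_vcomp[OF \<eta>(1) z(1) X pr(4)]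
          \<eta> z m PP whisker_left_id2[OF X pr(3)] whisker_left_id2[OF X pr(4)] P1 Q1)
    moreover have "\<eta> \<bullet> \<zeta> = id2 L (r \<cdot> P)"
      by (rule cell_eqI[OF rP vcomp_cell[OF z(1) \<eta>(1)] id2_cell'[OF rP]])
        (simp_all add: whisker_left_vcomp[OF z(1) \<eta>(1) rP pr(3)] whisker_left_vcomp[OF z(1) \<eta>(1) rP pr(4)]
          \<eta> z m PP whisker_left_id2[OF rP pr(3)] whisker_left_id2[OF rP pr(4)] PrP QrP)
    ultimately show ?thesis using invertible_cellI[OF \<eta>(1) z(1)] by blast
  qed
  ultimately have "reflection p A P r \<eta>"
    using reflectionI[OF pr(1,3) r(1,2) \<eta>(1,2)] by blast
  then show thesis using that r \<eta> by blast
qed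

lemma cone_at_section:
  assumes "reflection p A P r \<eta>" "Q \<cdot> r = f" "Q \<lhd> \<eta> = lam"
  shows "lam \<rhd> r = id2 L f"
proof -
  note D = reflectionD[OF assms(1) projections(3)]
  have X: "is_arr L (id1 L C) C C" using id1_arr projections by blast
  show ?thesis
    using whisker_left_right[OF D(4) X D(2) projections(4)] assms D(6)
      whisker_left_id2[OF D(2) projections(4)] by simp
qed

text \<open>
  The pair \<open>(s p', q)\<close> carries the cone \<open>q \<eta>' : q \<Rightarrow> q r' p' = f s p'\<close>. The induced \<open>u\<close> is tight because
  its two components are, and both equations required of a morphism of reflections can be checked
  after composing with the projections of the limit. With \<open>s = 1\<close> this compares two presentations
  of \<open>f\<close>; a general \<open>s\<close> is needed for composites \<open>f s\<close>.
\<close>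

lemma universal_reflection_morphism:
  assumes lim: "reflection p A P r \<eta>" "Q \<cdot> r = f" "Q \<lhd> \<eta> = lam"
    and refl: "reflection p A p' r' \<eta>'" "is_arr L p' X z"
    and q: "q \<in> Tight A" "is_arr L q X y" and s: "s \<in> Tight A" "is_arr L s z x"
    and eq: "q \<cdot> r' = f \<cdot> s"
  obtains u where "u \<in> Tight A" "is_arr L u X C" "Q \<cdot> u = q"
    "reflection_morphism A p' r' \<eta>' P r \<eta> u s"
proof -
  note pr = projections
  note D = reflectionD[OF lim(1) pr(3)] and D' = reflectionD[OF refl]
  have X: "is_arr L (id1 L X) X X" and C1: "is_arr L (id1 L C) C C"
    using refl(2) pr(3) id1_arr ob_arr by blast+
  have sp: "is_arr L (s \<cdot> p') X x" using comp1_arr s refl by blast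
  have qrp: "q \<cdot> (r' \<cdot> p') = f \<cdot> (s \<cdot> p')"
    using comp1_assoc[OF refl(2) D'(2) q(2)] comp1_assoc[OF refl(2) s(2) f] eq by simp
  have c: "is_cell L (q \<lhd> \<eta>') q (f \<cdot> (s \<cdot> p'))"
    using whisker_left_cell[OF D'(4) X q(2)] id1_right[OF q(2)] qrp by simp
  obtain u where u: "is_arr L u X C" "P \<cdot> u = s \<cdot> p'" "Q \<cdot> u = q" "lam \<rhd> u = q \<lhd> \<eta>'"
    using factor[OF sp q(2) c] invertible_whisker_left[OF D'(7) D'(4) X q(2)] by blast
  have ut: "u \<in> Tight A"
    using tight_iff[OF u(1)] u q tight_comp1[OF D'(1) s(1) refl(2) s(2)] by simp
  have ur: "is_arr L (u \<cdot> r') z C" and rs: "is_arr L (r \<cdot> s) z C"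
    using comp1_arr u D D' s by blast+
  have "u \<cdot> r' = r \<cdot> s"
  proof (rule arr_eqI[OF ur rs])
    have "P \<cdot> u \<cdot> r' = (s \<cdot> p') \<cdot> r'" using comp1_assoc[OF D'(2) u(1) pr(3)] u by simp
    also have "\<dots> = s" using comp1_assoc[OF D'(2) refl(2) s(2)] D'(3) id1_right[OF s(2)] by simp
    also have "\<dots> = P \<cdot> r \<cdot> s" using comp1_assoc[OF s(2) D(2) pr(3), symmetric] D(3) id1_left[OF s(2)] by simp
    finally show "P \<cdot> u \<cdot> r' = P \<cdot> r \<cdot> s" .
    show "Q \<cdot> u \<cdot> r' = Q \<cdot> r \<cdot> s"
      using comp1_assoc[OF D'(2) u(1) pr(4), symmetric] comp1_assoc[OF s(2) D(2) pr(4), symmetric] u lim eq by simp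
    have "lam \<rhd> (u \<cdot> r') = (q \<lhd> \<eta>') \<rhd> r'"
      using whisker_right_comp[OF pr(5,4) u(1) D'(2)] u by simp
    also have "\<dots> = id2 L (q \<cdot> r')"
      using whisker_left_right[OF D'(4) X D'(2) q(2)] D'(6) whisker_left_id2[OF D'(2) q(2)] by simp
    also have "\<dots> = lam \<rhd> (r \<cdot> s)"
      using whisker_right_comp[OF pr(5,4) D(2) s(2)] cone_at_section[OF lim] whisker_right_id2[OF s(2) f] eq by simp
    finally show "lam \<rhd> (u \<cdot> r') = lam \<rhd> (r \<cdot> s)" .
  qed
  have ue: "is_cell L (u \<lhd> \<eta>') u (u \<cdot> (r' \<cdot> p'))"
    using whisker_left_cell[OF D'(4) X u(1)] id1_right[OF u(1)] by simp
  have "(r \<cdot> P) \<cdot> u = u \<cdot> (r' \<cdot> p')"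
    using comp1_assoc[OF u(1) pr(3) D(2)] u(2) comp1_assoc[OF refl(2) s(2) D(2)]
      comp1_assoc[OF refl(2) D'(2) u(1)] \<open>u \<cdot> r' = r \<cdot> s\<close> by simp
  then have eu: "is_cell L (\<eta> \<rhd> u) u (u \<cdot> (r' \<cdot> p'))"
    using whisker_right_cell[OF D(4) C1 u(1)] id1_left[OF u(1)] by simp
  have "u \<lhd> \<eta>' = \<eta> \<rhd> u"
  proof (rule cell_eqI[OF u(1) ue eu])
    have "P \<lhd> u \<lhd> \<eta>' = s \<lhd> p' \<lhd> \<eta>'"
      using whisker_left_comp[OF D'(4) X u(1) pr(3)] whisker_left_comp[OF D'(4) X refl(2) s(2)] u by simp
    also have "\<dots> = id2 L (s \<cdot> p')" using D'(5) whisker_left_id2[OF refl(2) s(2)] by simp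
    also have "\<dots> = P \<lhd> \<eta> \<rhd> u"
      using whisker_left_right[OF D(4) C1 u(1) pr(3)] D(5) whisker_right_id2[OF u(1) pr(3)] u by simp
    finally show "P \<lhd> u \<lhd> \<eta>' = P \<lhd> \<eta> \<rhd> u" .
    show "Q \<lhd> u \<lhd> \<eta>' = Q \<lhd> \<eta> \<rhd> u"
      using whisker_left_comp[OF D'(4) X u(1) pr(4)] whisker_left_right[OF D(4) C1 u(1) pr(4)] u lim by simp
  qed
  then have "reflection_morphism A p' r' \<eta>' P r \<eta> u s"
    using \<open>u \<cdot> r' = r \<cdot> s\<close> u ut s pr D'(1) refl(2)
    by (simp add: reflection_morphism_def tight_square_def L_eq Let_def is_arr_def)
  then show thesis using that u ut by blast
qed

text \<open>
  Here \<open>t\<close> is induced by the cone \<open>(p', (\<alpha> p') (q \<eta>'), q)\<close>. It commutes with the reflections only up to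
  the mate \<open>t r' \<Rightarrow> r\<close>, which is \<open>\<eta> t r'\<close>, and applying \<open>Q\<close> to the mate returns \<open>\<alpha>\<close>. When
  units are invertible the cone is invertible only if \<open>\<alpha>\<close> is, so the argument is confined to the lax
  case.
\<close>

lemma lax_cell_factorization:
  assumes lim: "reflection p A P r \<eta>" "Q \<lhd> \<eta> = lam" and "\<not> p"
    and refl: "reflection p A p' r' \<eta>'" "is_arr L p' X x"
    and q: "q \<in> Tight A" "is_arr L q X y" and \<alpha>: "is_cell L \<alpha> (q \<cdot> r') f"
  obtains t where "t \<in> Tight A" "is_arr L t X C" "P \<cdot> t = p'" "Q \<cdot> t = q"
    "Q \<lhd> \<eta> \<rhd> (t \<cdot> r') = \<alpha>"
proof -
  note pr = projections
  note D = reflectionD[OF lim(1) pr(3)] and D' = reflectionD[OF refl]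
  have X: "is_arr L (id1 L X) X X" and C1: "is_arr L (id1 L C) C C"
    using refl(2) pr(3) id1_arr ob_arr by blast+
  have qr: "is_arr L (q \<cdot> r') x y" using comp1_arr q D' by blast
  have c1: "is_cell L (q \<lhd> \<eta>') q ((q \<cdot> r') \<cdot> p')"
    using whisker_left_cell[OF D'(4) X q(2)] id1_right[OF q(2)] comp1_assoc[OF refl(2) D'(2) q(2)] by simp
  have c2: "is_cell L (\<alpha> \<rhd> p') ((q \<cdot> r') \<cdot> p') (f \<cdot> p')"
    using whisker_right_cell[OF \<alpha> qr refl(2)] .
  obtain t where t: "is_arr L t X C" "P \<cdot> t = p'" "Q \<cdot> t = q" "lam \<rhd> t = (\<alpha> \<rhd> p') \<bullet> (q \<lhd> \<eta>')"
    using factor[OF refl(2) q(2) vcomp_cell[OF c1 c2]] \<open>\<not> p\<close> by blast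
  have tt: "t \<in> Tight A" using tight_iff[OF t(1)] t q D'(1) by simp
  have tr: "is_arr L (t \<cdot> r') x C" using comp1_arr t D' by blast
  have "Q \<lhd> \<eta> \<rhd> (t \<cdot> r') = (lam \<rhd> t) \<rhd> r'"
    using whisker_left_right[OF D(4) C1 tr pr(4)] lim whisker_right_comp[OF pr(5,4) t(1) D'(2)] by simp
  also have "\<dots> = ((\<alpha> \<rhd> p') \<rhd> r') \<bullet> ((q \<lhd> \<eta>') \<rhd> r')"
    using t(4) whisker_right_vcomp[OF c1 c2 q(2) D'(2)] by simp
  also have "(\<alpha> \<rhd> p') \<rhd> r' = \<alpha>"
    using whisker_right_comp[OF \<alpha> qr refl(2) D'(2)] D'(3) whisker_right_id1[OF \<alpha> qr] by simp
  also have "(q \<lhd> \<eta>') \<rhd> r' = id2 L (q \<cdot> r')"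
    using whisker_left_right[OF D'(4) X D'(2) q(2)] D'(6) whisker_left_id2[OF D'(2) q(2)] by simp
  also have "\<alpha> \<bullet> id2 L (q \<cdot> r') = \<alpha>" using id2_right[OF \<alpha>] .
  finally show thesis using that t tt by blast
qed

end

section \<open>F-functors preserve reflections and their morphisms\<close>

locale F_fun = dom: F_cat A L + cod: F_cat B M
  for A :: "('o, 't1, 't2, 'l1, 'l2) fcat" and L :: "('o, 'l1, 'l2) twocat"
    and B :: "('bo, 'bt1, 'bt2, 'bl1, 'bl2) fcat" and M :: "('bo, 'bl1, 'bl2) twocat" +
  fixes F :: "('o, 'l1, 'l2, 'bo, 'bl1, 'bl2) twofun"
  assumes F_functor: "F_functor A B F"
begin

sublocale two_functor_on L M F
  using F_functor by unfold_locales (simp add: F_functor_def dom.L_eq cod.L_eq)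

lemma F_tight: "f \<in> Tight A \<Longrightarrow> F1 F f \<in> Tight B"
  using F_functor by (auto simp: F_functor_def)

lemma F_reflection:
  assumes "reflection p A f g \<eta>"
  shows "reflection p B (F1 F f) (F1 F g) (F2 F \<eta>)"
proof -
  define x y where "x = dom1 L f" "y = cod1 L f"
  then have f: "is_arr L f x y" using dom.reflection_arr[OF assms] by simp
  note D = dom.reflectionD[OF assms f]
  have id: "is_arr L (id1 L x) x x" using f dom.ob_arr dom.id1_arr by blast
  have F_id: "F1 F (id1 L x) = id1 M (F0 F x)" "F1 F (id1 L y) = id1 M (F0 F y)"
    using F_id1 dom.ob_arr f by blast+
  show ?thesis
  proof (rule cod.reflectionI[OF F_tight[OF D(1)] F_arr[OF f] F_arr[OF D(2)]])
    show "F1 F f \<cdot>\<^bsub>M\<^esub> F1 F g = id1 M (F0 F y)"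
      using F_comp1[OF D(2) f] by (simp add: D(3) F_id)
    show "is_cell M (F2 F \<eta>) (id1 M (F0 F x)) (F1 F g \<cdot>\<^bsub>M\<^esub> F1 F f)"
      using F_cell[OF D(4)] by (simp add: F_comp1[OF f D(2)] F_id)
    show "F1 F f \<lhd>\<^bsub>M\<^esub> F2 F \<eta> = id2 M (F1 F f)"
      using F_whisker_left[OF D(4) id f] by (simp add: D(5) F_id2[OF f])
    show "F2 F \<eta> \<rhd>\<^bsub>M\<^esub> F1 F g = id2 M (F1 F g)"
      using F_whisker_right[OF D(4) id D(2)] by (simp add: D(6) F_id2[OF D(2)])
    show "p \<Longrightarrow> invertible_cell M (F2 F \<eta>)"
      using F_invertible D by blast
  qed
qed

lemma F_reflection_morphism:
  assumes 1: "reflection p A f\<^sub>1 g\<^sub>1 \<eta>\<^sub>1" and 2: "reflection p A f\<^sub>2 g\<^sub>2 \<eta>\<^sub>2"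
    and m: "reflection_morphism A f\<^sub>1 g\<^sub>1 \<eta>\<^sub>1 f\<^sub>2 g\<^sub>2 \<eta>\<^sub>2 r s"
  shows "reflection_morphism B (F1 F f\<^sub>1) (F1 F g\<^sub>1) (F2 F \<eta>\<^sub>1) (F1 F f\<^sub>2) (F1 F g\<^sub>2) (F2 F \<eta>\<^sub>2)
           (F1 F r) (F1 F s)"
proof -
  define x\<^sub>1 y\<^sub>1 x\<^sub>2 y\<^sub>2 where "x\<^sub>1 = dom1 L f\<^sub>1" "y\<^sub>1 = cod1 L f\<^sub>1" "x\<^sub>2 = dom1 L f\<^sub>2" "y\<^sub>2 = cod1 L f\<^sub>2"
  then have f1: "is_arr L f\<^sub>1 x\<^sub>1 y\<^sub>1" and f2: "is_arr L f\<^sub>2 x\<^sub>2 y\<^sub>2"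
    using dom.reflection_arr 1 2 by blast+
  note D1 = dom.reflectionD[OF 1 f1] and D2 = dom.reflectionD[OF 2 f2]
  have r: "is_arr L r x\<^sub>1 x\<^sub>2" "r \<in> Tight A" and s: "is_arr L s y\<^sub>1 y\<^sub>2" "s \<in> Tight A"
    and sq: "f\<^sub>2 \<cdot>\<^bsub>L\<^esub> r = s \<cdot>\<^bsub>L\<^esub> f\<^sub>1" and sq': "g\<^sub>2 \<cdot>\<^bsub>L\<^esub> s = r \<cdot>\<^bsub>L\<^esub> g\<^sub>1"
    and u: "r \<lhd>\<^bsub>L\<^esub> \<eta>\<^sub>1 = \<eta>\<^sub>2 \<rhd>\<^bsub>L\<^esub> r"
    using m f1 f2 by (auto simp: reflection_morphism_def tight_square_def dom.L_eq Let_def is_arr_def)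
  have id: "is_arr L (id1 L x\<^sub>1) x\<^sub>1 x\<^sub>1" "is_arr L (id1 L x\<^sub>2) x\<^sub>2 x\<^sub>2"
    using f1 f2 dom.ob_arr dom.id1_arr by blast+
  have "F1 F f\<^sub>2 \<cdot>\<^bsub>M\<^esub> F1 F r = F1 F s \<cdot>\<^bsub>M\<^esub> F1 F f\<^sub>1"
    using F_comp1[OF r(1) f2] F_comp1[OF f1 s(1)] sq by argo
  moreover have "F1 F g\<^sub>2 \<cdot>\<^bsub>M\<^esub> F1 F s = F1 F r \<cdot>\<^bsub>M\<^esub> F1 F g\<^sub>1"
    using F_comp1[OF s(1) D2(2)] F_comp1[OF D1(2) r(1)] sq' by argo
  moreover have "F1 F r \<lhd>\<^bsub>M\<^esub> F2 F \<eta>\<^sub>1 = F2 F \<eta>\<^sub>2 \<rhd>\<^bsub>M\<^esub> F1 F r"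
    using F_whisker_left[OF D1(4) id(1) r(1)] F_whisker_right[OF D2(4) id(2) r(1)] u by argo
  ultimately show ?thesis
    using F_arr[OF f1] F_arr[OF f2] F_arr[OF r(1)] F_arr[OF s(1)] r s D1(1) D2(1) F_tight
    by (simp add: reflection_morphism_def tight_square_def cod.L_eq Let_def is_arr_def)
qed

end

section \<open>Lifting reflections through the commuting square\<close>

text \<open>
  The boolean \<open>p\<close> selects the pseudo case and its negation the lax case. The two are treated together
  until the construction of the filler on 2-cells, where the arguments part.
\<close>

locale lifting_problem = A: F_cat A L + B: F_cat B M + C: F_cat C N
  for A :: "('o, 't1, 't2, 'l1, 'l2) fcat" and L :: "('o, 'l1, 'l2) twocat"
    and B :: "('bo, 'bt1, 'bt2, 'bl1, 'bl2) fcat" and M :: "('bo, 'bl1, 'bl2) twocat"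
    and C :: "('co, 'ct1, 'ct2, 'cl1, 'cl2) fcat" and N :: "('co, 'cl1, 'cl2) twocat" +
  fixes p :: bool
    and H :: "('bo, 'bl1, 'bl2, 'co, 'cl1, 'cl2) twofun"
    and R :: "('o, 't1, 't2, 'bo, 'bl1, 'bl2) twofun"
    and S :: "('o, 'l1, 'l2, 'co, 'cl1, 'cl2) twofun"
  assumes limits: "f \<in> Arr L \<Longrightarrow> \<exists>C P lam Q. colax_limit p A f C P lam Q"
    and H_functor: "F_functor B C H"
    and H_Refl: "Refl_at p B C H" and H_Morph: "Morph_at p B C H" and H_faithful: "locally_faithful B H"
    and R_functor: "F_functor (all_tight (tight_cat A)) B R"
    and S_functor: "F_functor A C S"
    and square: "F_comp (all_tight (tight_cat A)) H R = F_comp (all_tight (tight_cat A)) S (incl A)"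
begin

abbreviation comp1_L (infixr "\<cdot>" 75) where "comp1_L \<equiv> comp1 L"
abbreviation comp1_M (infixr "\<cdot>''" 75) where "comp1_M \<equiv> comp1 M"

sublocale H: F_fun B M C N H
  by unfold_locales (rule H_functor)

sublocale S: F_fun A L C N S
  by unfold_locales (rule S_functor)

sublocale R: two_functor_on "tight_cat A" M R
  using R_functor by unfold_locales (simp add: F_functor_def all_tight_def B.L_eq)

lemma square0: "x \<in> Ob L \<Longrightarrow> F0 H (F0 R x) = F0 S x"
proof -
  assume x: "x \<in> Ob L"
  have "F0 (F_comp (all_tight (tight_cat A)) H R) x = F0 (F_comp (all_tight (tight_cat A)) S (incl A)) x"
    using square by simp
  then show ?thesis
    using x by (simp add: F_comp_def two_comp_def all_tight_def compose_def A.Ob_tight A.F0_incl)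
qed

lemma square1: "f \<in> Arr (tight_cat A) \<Longrightarrow> F1 H (F1 R f) = F1 S (F1 (incl A) f)"
proof -
  assume f: "f \<in> Arr (tight_cat A)"
  have "F1 (F_comp (all_tight (tight_cat A)) H R) f = F1 (F_comp (all_tight (tight_cat A)) S (incl A)) f"
    using square by simp
  then show ?thesis
    using f by (simp add: F_comp_def two_comp_def all_tight_def compose_def)
qed

lemma square2: "\<alpha> \<in> Cell (tight_cat A) \<Longrightarrow> F2 H (F2 R \<alpha>) = F2 S (F2 (incl A) \<alpha>)"
proof -
  assume a: "\<alpha> \<in> Cell (tight_cat A)"
  have "F2 (F_comp (all_tight (tight_cat A)) H R) \<alpha> = F2 (F_comp (all_tight (tight_cat A)) S (incl A)) \<alpha>"
    using square by simp
  then show ?thesis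
    using a by (simp add: F_comp_def two_comp_def all_tight_def compose_def)
qed

lemma faithful: "is_cell M \<alpha> f g \<Longrightarrow> is_cell M \<beta> f g \<Longrightarrow> F2 H \<alpha> = F2 H \<beta> \<Longrightarrow> \<alpha> = \<beta>"
  using H_faithful unfolding locally_faithful_def B.L_eq by blast

text \<open>
  \<open>R\<close> is defined on the tight 2-category, whereas all constructions above take place in the loose one;
  \<open>R1\<close> is the action of \<open>R\<close> transported to the tight morphisms among the loose ones.
\<close>

definition R1 :: "'l1 \<Rightarrow> 'bl1" where
  "R1 f = F1 R (the_inv_into (Arr (tight_cat A)) (F1 (incl A)) f)"

lemma R1_incl: "f \<in> Arr (tight_cat A) \<Longrightarrow> R1 (F1 (incl A) f) = F1 R f"
  unfolding R1_def using A.F_category by (simp add: F_category_def the_inv_into_f_f)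

lemma R1_arr:
  assumes "f \<in> Tight A" "is_arr L f x y"
  shows "is_arr M (R1 f) (F0 R x) (F0 R y)" "R1 f \<in> Tight B" "F1 H (R1 f) = F1 S f"
proof -
  obtain g where g: "is_arr (tight_cat A) g x y" "F1 (incl A) g = f"
    using A.tight_preimage[OF assms] .
  have gA: "g \<in> Arr (tight_cat A)" using is_arrE[OF g(1)] by blast
  have Rf: "R1 f = F1 R g" using R1_incl[OF gA] g by simp
  show "is_arr M (R1 f) (F0 R x) (F0 R y)" using R.F_arr[OF g(1)] Rf by simp
  show "F1 H (R1 f) = F1 S f" using square1[OF gA] Rf g by simp
  have "F1 R ` Arr (tight_cat A) \<subseteq> Tight B"
    using R_functor by (auto simp: F_functor_def all_tight_def Tight_def two_id_def)
  then show "R1 f \<in> Tight B" using gA Rf by auto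
qed

lemma R1_id1: "x \<in> Ob L \<Longrightarrow> R1 (id1 L x) = id1 M (F0 R x)"
proof -
  assume x: "x \<in> Ob L"
  then have "is_arr (tight_cat A) (id1 (tight_cat A) x) x x" using A.incl.dom.id1_arr A.Ob_tight by simp
  from R1_incl[OF is_arrE(1)[OF this]] show ?thesis
    using A.incl.F_id1[of x] R.F_id1[of x] x by (simp add: A.Ob_tight A.F0_incl)
qed

lemma R1_comp1:
  assumes "f \<in> Tight A" "is_arr L f x y" "g \<in> Tight A" "is_arr L g y z"
  shows "R1 (g \<cdot> f) = R1 g \<cdot>' R1 f"
proof -
  obtain f' where f': "is_arr (tight_cat A) f' x y" "F1 (incl A) f' = f"
    using A.tight_preimage[OF assms(1,2)] .
  obtain g' where g': "is_arr (tight_cat A) g' y z" "F1 (incl A) g' = g"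
    using A.tight_preimage[OF assms(3,4)] .
  have "R1 (g \<cdot> f) = F1 R (g' \<cdot>\<^bsub>tight_cat A\<^esub> f')"
    using R1_incl[OF is_arrE(1)[OF A.incl.dom.comp1_arr[OF f'(1) g'(1)]]]
    unfolding A.incl.F_comp1[OF f'(1) g'(1)] f'(2) g'(2) .
  also have "\<dots> = R1 g \<cdot>' R1 f"
    using R1_incl[OF is_arrE(1)[OF f'(1)]] R1_incl[OF is_arrE(1)[OF g'(1)]]
    unfolding R.F_comp1[OF f'(1) g'(1)] f'(2) g'(2) by argo
  finally show ?thesis .
qed

lemma tight_cell_preimage:
  assumes "f \<in> Arr (tight_cat A)" "g \<in> Arr (tight_cat A)"
    "is_cell L \<alpha> (F1 (incl A) f) (F1 (incl A) g)"
  obtains \<beta> where "is_cell (tight_cat A) \<beta> f g" "F2 (incl A) \<beta> = \<alpha>"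
proof -
  have f: "is_arr L (F1 (incl A) f) (dom1 (tight_cat A) f) (cod1 (tight_cat A) f)"
    and g: "is_arr L (F1 (incl A) g) (dom1 (tight_cat A) g) (cod1 (tight_cat A) g)"
    by (rule A.incl_arr[OF is_arrI[OF assms(1)]], rule A.incl_arr[OF is_arrI[OF assms(2)]])
  have "parallel1 (tight_cat A) f g"
    using A.cell_trg[OF assms(3) f] g assms(1,2) by (simp add: parallel1_def is_arr_def)
  then have "bij_betw (F2 (incl A)) {\<alpha>. is_cell (tight_cat A) \<alpha> f g}
          {\<alpha>. is_cell L \<alpha> (F1 (incl A) f) (F1 (incl A) g)}"
    using A.F_category by (simp add: F_category_def A.L_eq)
  then have "\<alpha> \<in> F2 (incl A) ` {\<alpha>. is_cell (tight_cat A) \<alpha> f g}"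
    using assms(3) by (simp add: bij_betw_def)
  then show thesis using that by blast
qed

lemma tight_cell_lift:
  assumes "f \<in> Tight A" "g \<in> Tight A" "is_cell L \<alpha> f g"
  obtains \<beta> where "is_cell M \<beta> (R1 f) (R1 g)" "F2 H \<beta> = F2 S \<alpha>"
proof -
  obtain f' g' where fg: "f' \<in> Arr (tight_cat A)" "F1 (incl A) f' = f"
      "g' \<in> Arr (tight_cat A)" "F1 (incl A) g' = g"
    using assms(1,2) by (auto simp: Tight_def)
  obtain \<gamma> where g: "is_cell (tight_cat A) \<gamma> f' g'" "F2 (incl A) \<gamma> = \<alpha>"
    using tight_cell_preimage[OF fg(1,3), of \<alpha>] fg assms(3) by auto
  have "is_cell M (F2 R \<gamma>) (R1 f) (R1 g)"
    using R.F_cell[OF g(1)] R1_incl[OF fg(1)] R1_incl[OF fg(3)] fg by simp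
  moreover have "F2 H (F2 R \<gamma>) = F2 S \<alpha>"
    using square2[OF is_cellE(1)[OF g(1)]] g by simp
  ultimately show thesis using that by blast
qed

text \<open>
  A tight left adjoint has an image in \<open>\<bbbB>\<close>, that under \<open>R\<close>; its right adjoint and unit have images
  in \<open>\<bbbC>\<close> only, and those are lifted along \<open>H\<close>.
\<close>

definition lifts :: "'l1 \<Rightarrow> 'l1 \<Rightarrow> 'l2 \<Rightarrow> 'bl1 \<Rightarrow> 'bl2 \<Rightarrow> bool" where
  "lifts f g \<eta> g' \<eta>' \<longleftrightarrow> reflection p B (R1 f) g' \<eta>' \<and> F1 H g' = F1 S g \<and> F2 H \<eta>' = F2 S \<eta>"

lemma lift_exists:
  assumes "reflection p A f g \<eta>"
  obtains g' \<eta>' where "lifts f g \<eta> g' \<eta>'"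
proof -
  have f: "is_arr L f (dom1 L f) (cod1 L f)" using A.reflection_arr[OF assms] .
  note Rf = R1_arr[OF A.reflectionD(1)[OF assms f] f]
  have "reflection p C (F1 H (R1 f)) (F1 S g) (F2 S \<eta>)"
    using S.F_reflection[OF assms] Rf by simp
  then have "\<exists>!(g', \<eta>'). reflection p B (R1 f) g' \<eta>' \<and> F1 H g' = F1 S g \<and> F2 H \<eta>' = F2 S \<eta>"
    using H_Refl Rf(2) unfolding Refl_at_def by blast
  then show thesis using that unfolding lifts_def by auto
qed

lemma lift_arr:
  assumes "reflection p A f g \<eta>" "is_arr L f x y" "lifts f g \<eta> g' \<eta>'"
  shows "is_arr M g' (F0 R y) (F0 R x)"
  using B.reflectionD(2)[of p "R1 f" g' \<eta>'] R1_arr(1)[OF A.reflectionD(1)[OF assms(1,2)] assms(2)] assms(3)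
  unfolding lifts_def by blast

lemma lift_comp:
  assumes 1: "reflection p A f\<^sub>1 g\<^sub>1 \<eta>\<^sub>1" "is_arr L f\<^sub>1 x y" "lifts f\<^sub>1 g\<^sub>1 \<eta>\<^sub>1 g\<^sub>1' \<eta>\<^sub>1'"
    and 2: "reflection p A f\<^sub>2 g\<^sub>2 \<eta>\<^sub>2" "is_arr L f\<^sub>2 y z" "lifts f\<^sub>2 g\<^sub>2 \<eta>\<^sub>2 g\<^sub>2' \<eta>\<^sub>2'"
  shows "lifts (f\<^sub>2 \<cdot> f\<^sub>1) (g\<^sub>1 \<cdot> g\<^sub>2) ((g\<^sub>1 \<lhd>\<^bsub>L\<^esub> \<eta>\<^sub>2 \<rhd>\<^bsub>L\<^esub> f\<^sub>1) \<bullet>\<^bsub>L\<^esub> \<eta>\<^sub>1)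
    (g\<^sub>1' \<cdot>' g\<^sub>2') ((g\<^sub>1' \<lhd>\<^bsub>M\<^esub> \<eta>\<^sub>2' \<rhd>\<^bsub>M\<^esub> R1 f\<^sub>1) \<bullet>\<^bsub>M\<^esub> \<eta>\<^sub>1')"
proof -
  note D1 = A.reflectionD[OF 1(1,2)] and D2 = A.reflectionD[OF 2(1,2)]
  note R1f = R1_arr[OF D1(1) 1(2)] and R2f = R1_arr[OF D2(1) 2(2)]
  have l1: "reflection p B (R1 f\<^sub>1) g\<^sub>1' \<eta>\<^sub>1'" "F1 H g\<^sub>1' = F1 S g\<^sub>1" "F2 H \<eta>\<^sub>1' = F2 S \<eta>\<^sub>1"
    and l2: "reflection p B (R1 f\<^sub>2) g\<^sub>2' \<eta>\<^sub>2'" "F1 H g\<^sub>2' = F1 S g\<^sub>2" "F2 H \<eta>\<^sub>2' = F2 S \<eta>\<^sub>2"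
    using 1(3) 2(3) unfolding lifts_def by blast+
  note E1 = B.reflectionD[OF l1(1) R1f(1)] and E2 = B.reflectionD[OF l2(1) R2f(1)]
  have y: "is_arr L (id1 L y) y y" and Ry: "is_arr M (id1 M (F0 R y)) (F0 R y) (F0 R y)"
    using A.ob_arr A.id1_arr 1(2) B.ob_arr B.id1_arr R1f(1) by blast+
  have c1: "is_cell L (\<eta>\<^sub>2 \<rhd>\<^bsub>L\<^esub> f\<^sub>1) f\<^sub>1 ((g\<^sub>2 \<cdot> f\<^sub>2) \<cdot> f\<^sub>1)"
    using A.whisker_right_cell[OF D2(4) y 1(2)] A.id1_left[OF 1(2)] by simp
  have c1': "is_cell M (\<eta>\<^sub>2' \<rhd>\<^bsub>M\<^esub> R1 f\<^sub>1) (R1 f\<^sub>1) ((g\<^sub>2' \<cdot>' R1 f\<^sub>2) \<cdot>' R1 f\<^sub>1)"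
    using B.whisker_right_cell[OF E2(4) Ry R1f(1)] B.id1_left[OF R1f(1)] by simp
  have c2: "is_cell L (g\<^sub>1 \<lhd>\<^bsub>L\<^esub> \<eta>\<^sub>2 \<rhd>\<^bsub>L\<^esub> f\<^sub>1) (g\<^sub>1 \<cdot> f\<^sub>1) (g\<^sub>1 \<cdot> (g\<^sub>2 \<cdot> f\<^sub>2) \<cdot> f\<^sub>1)"
    using A.whisker_left_cell[OF c1 1(2) D1(2)] .
  have c2': "is_cell M (g\<^sub>1' \<lhd>\<^bsub>M\<^esub> \<eta>\<^sub>2' \<rhd>\<^bsub>M\<^esub> R1 f\<^sub>1) (g\<^sub>1' \<cdot>' R1 f\<^sub>1) (g\<^sub>1' \<cdot>' (g\<^sub>2' \<cdot>' R1 f\<^sub>2) \<cdot>' R1 f\<^sub>1)"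
    using B.whisker_left_cell[OF c1' R1f(1) E1(2)] .
  have "F2 H ((g\<^sub>1' \<lhd>\<^bsub>M\<^esub> \<eta>\<^sub>2' \<rhd>\<^bsub>M\<^esub> R1 f\<^sub>1) \<bullet>\<^bsub>M\<^esub> \<eta>\<^sub>1') =
    (F1 S g\<^sub>1 \<lhd>\<^bsub>N\<^esub> F2 S \<eta>\<^sub>2 \<rhd>\<^bsub>N\<^esub> F1 S f\<^sub>1) \<bullet>\<^bsub>N\<^esub> F2 S \<eta>\<^sub>1"
    by (simp only: H.F_vcomp[OF E1(4) c2'] H.F_whisker_left[OF c1' R1f(1) E1(2)]
        H.F_whisker_right[OF E2(4) Ry R1f(1)] l1 l2 R1f(3))
  also have "\<dots> = F2 S ((g\<^sub>1 \<lhd>\<^bsub>L\<^esub> \<eta>\<^sub>2 \<rhd>\<^bsub>L\<^esub> f\<^sub>1) \<bullet>\<^bsub>L\<^esub> \<eta>\<^sub>1)"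
    by (simp only: S.F_vcomp[OF D1(4) c2] S.F_whisker_left[OF c1 1(2) D1(2)]
        S.F_whisker_right[OF D2(4) y 1(2)])
  finally have "F2 H ((g\<^sub>1' \<lhd>\<^bsub>M\<^esub> \<eta>\<^sub>2' \<rhd>\<^bsub>M\<^esub> R1 f\<^sub>1) \<bullet>\<^bsub>M\<^esub> \<eta>\<^sub>1') = F2 S ((g\<^sub>1 \<lhd>\<^bsub>L\<^esub> \<eta>\<^sub>2 \<rhd>\<^bsub>L\<^esub> f\<^sub>1) \<bullet>\<^bsub>L\<^esub> \<eta>\<^sub>1)" .
  moreover have "F1 H (g\<^sub>1' \<cdot>' g\<^sub>2') = F1 S (g\<^sub>1 \<cdot> g\<^sub>2)"
    by (simp only: H.F_comp1[OF E2(2) E1(2)] S.F_comp1[OF D2(2) D1(2)] l1 l2)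
  ultimately show ?thesis
    unfolding lifts_def R1_comp1[OF D1(1) 1(2) D2(1) 2(2)]
    using B.reflection_comp[OF l1(1) R1f(1) l2(1) R2f(1)] by blast
qed

lemma lift_id1:
  assumes x: "x \<in> Ob L"
  shows "lifts (id1 L x) (id1 L x) (id2 L (id1 L x)) (id1 M (F0 R x)) (id2 M (id1 M (F0 R x)))"
proof -
  note i = A.id1_arr[OF x]
  have Rx: "F0 R x \<in> Ob M" using B.ob_arr R1_arr(1)[OF A.tight_id1[OF x] i] by blast
  have "F1 H (id1 M (F0 R x)) = F1 S (id1 L x)"
    using H.F_id1[OF Rx] S.F_id1[OF x] square0[OF x] by simp
  then show ?thesis
    unfolding lifts_def R1_id1[OF x]
    using B.reflection_id1[OF Rx] H.F_id2[OF B.id1_arr[OF Rx]] S.F_id2[OF i] by simp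
qed

text \<open>
  The image under \<open>S\<close> of a morphism of reflections is the image under \<open>H\<close> of the square
  \<open>(R u, R s)\<close> between the lifts; \<open>H\<close> detects morphisms of reflections among tight squares.
\<close>

lemma lift_morphism:
  assumes 1: "reflection p A f\<^sub>1 g\<^sub>1 \<eta>\<^sub>1" "lifts f\<^sub>1 g\<^sub>1 \<eta>\<^sub>1 g\<^sub>1' \<eta>\<^sub>1'"
    and 2: "reflection p A f\<^sub>2 g\<^sub>2 \<eta>\<^sub>2" "lifts f\<^sub>2 g\<^sub>2 \<eta>\<^sub>2 g\<^sub>2' \<eta>\<^sub>2'"
    and m: "reflection_morphism A f\<^sub>1 g\<^sub>1 \<eta>\<^sub>1 f\<^sub>2 g\<^sub>2 \<eta>\<^sub>2 u s"
  shows "g\<^sub>2' \<cdot>' R1 s = R1 u \<cdot>' g\<^sub>1'"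
proof -
  define x\<^sub>1 y\<^sub>1 x\<^sub>2 y\<^sub>2 where "x\<^sub>1 = dom1 L f\<^sub>1" "y\<^sub>1 = cod1 L f\<^sub>1" "x\<^sub>2 = dom1 L f\<^sub>2" "y\<^sub>2 = cod1 L f\<^sub>2"
  then have f1: "is_arr L f\<^sub>1 x\<^sub>1 y\<^sub>1" and f2: "is_arr L f\<^sub>2 x\<^sub>2 y\<^sub>2"
    using A.reflection_arr 1 2 by blast+
  note t1 = A.reflectionD(1)[OF 1(1) f1] and t2 = A.reflectionD(1)[OF 2(1) f2]
  have u: "u \<in> Tight A" "is_arr L u x\<^sub>1 x\<^sub>2" and s: "s \<in> Tight A" "is_arr L s y\<^sub>1 y\<^sub>2"
    and sq: "f\<^sub>2 \<cdot> u = s \<cdot> f\<^sub>1"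
    using m f1 f2 by (auto simp: reflection_morphism_def tight_square_def A.L_eq Let_def is_arr_def)
  note Rf1 = R1_arr[OF t1 f1] and Rf2 = R1_arr[OF t2 f2] and Ru = R1_arr[OF u] and Rs = R1_arr[OF s]
  have l1: "reflection p B (R1 f\<^sub>1) g\<^sub>1' \<eta>\<^sub>1'" "F1 H g\<^sub>1' = F1 S g\<^sub>1" "F2 H \<eta>\<^sub>1' = F2 S \<eta>\<^sub>1"
    and l2: "reflection p B (R1 f\<^sub>2) g\<^sub>2' \<eta>\<^sub>2'" "F1 H g\<^sub>2' = F1 S g\<^sub>2" "F2 H \<eta>\<^sub>2' = F2 S \<eta>\<^sub>2"
    using 1(2) 2(2) unfolding lifts_def by blast+
  have "R1 f\<^sub>2 \<cdot>' R1 u = R1 s \<cdot>' R1 f\<^sub>1"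
    using R1_comp1[OF u t2 f2] R1_comp1[OF t1 f1 s] sq by argo
  then have "tight_square B (R1 f\<^sub>1) (R1 f\<^sub>2) (R1 u) (R1 s)"
    using Rf1 Rf2 Ru Rs by (simp add: tight_square_def B.L_eq Let_def is_arr_def)
  moreover have "reflection_morphism C (F1 H (R1 f\<^sub>1)) (F1 H g\<^sub>1') (F2 H \<eta>\<^sub>1')
      (F1 H (R1 f\<^sub>2)) (F1 H g\<^sub>2') (F2 H \<eta>\<^sub>2') (F1 H (R1 u)) (F1 H (R1 s))"
    using S.F_reflection_morphism[OF 1(1) 2(1) m] by (simp only: l1 l2 Rf1(3) Rf2(3) Ru(3) Rs(3))
  ultimately have "reflection_morphism B (R1 f\<^sub>1) g\<^sub>1' \<eta>\<^sub>1' (R1 f\<^sub>2) g\<^sub>2' \<eta>\<^sub>2' (R1 u) (R1 s)"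
    using H_Morph l1(1) l2(1) unfolding Morph_at_def by blast
  then show ?thesis by (simp add: reflection_morphism_def B.L_eq Let_def)
qed

section \<open>The filler on morphisms\<close>

text \<open>
  The property that characterizes the value \<open>k = K f\<close>. Stating it for all reflections and all tight
  \<open>s\<close> at once, rather than for the chosen limit of \<open>f\<close>, makes \<open>K f\<close> computable from whichever
  presentation is at hand.
\<close>

definition extends_at :: "'l1 \<Rightarrow> 'bl1 \<Rightarrow> bool" where
  "extends_at f k \<longleftrightarrow>
     is_arr M k (F0 R (dom1 L f)) (F0 R (cod1 L f)) \<and> F1 H k = F1 S f \<and>
     (\<forall>X z f' r \<eta> r' \<eta>' q s.
        reflection p A f' r \<eta> \<longrightarrow> is_arr L f' X z \<longrightarrow> lifts f' r \<eta> r' \<eta>' \<longrightarrow>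
        q \<in> Tight A \<longrightarrow> is_arr L q X (cod1 L f) \<longrightarrow> s \<in> Tight A \<longrightarrow> is_arr L s z (dom1 L f) \<longrightarrow>
        q \<cdot> r = f \<cdot> s \<longrightarrow> R1 q \<cdot>' r' = k \<cdot>' R1 s)"

lemma extends_at_exists:
  assumes f: "is_arr L f x y"
  shows "\<exists>k. extends_at f k"
proof -
  have dc: "dom1 L f = x" "cod1 L f = y" "f \<in> Arr L" using is_arrE[OF f] by blast+
  obtain Cf P lam Q where "colax_limit p A f Cf P lam Q"
    using limits[OF dc(3)] by blast
  then interpret lim: loose_limit A L p f Cf P lam Q x y
    by unfold_locales (use f in auto)
  obtain r \<eta> where r: "reflection p A P r \<eta>" "Q \<cdot> r = f" "Q \<lhd>\<^bsub>L\<^esub> \<eta> = lam"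
    using lim.projection_reflection .
  obtain r' \<eta>' where l: "lifts P r \<eta> r' \<eta>'" using lift_exists[OF r(1)] .
  note RQ = R1_arr[OF lim.projections(2,4)]
  note rarr = A.reflectionD(2)[OF r(1) lim.projections(3)]
  note r'arr = lift_arr[OF r(1) lim.projections(3) l]
  have "extends_at f (R1 Q \<cdot>' r')"
    unfolding extends_at_def dc
  proof (intro conjI allI impI)
    show "is_arr M (R1 Q \<cdot>' r') (F0 R x) (F0 R y)" using B.comp1_arr[OF r'arr RQ(1)] .
    have "F1 H r' = F1 S r" using l unfolding lifts_def by blast
    then show "F1 H (R1 Q \<cdot>' r') = F1 S f"
      using H.F_comp1[OF r'arr RQ(1)] S.F_comp1[OF rarr lim.projections(4)] RQ(3) r(2) by simp
    fix X z f' r2 \<eta>2 r2' \<eta>2' q s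
    assume 2: "reflection p A f' r2 \<eta>2" "is_arr L f' X z" "lifts f' r2 \<eta>2 r2' \<eta>2'"
      and q: "q \<in> Tight A" "is_arr L q X y" and s: "s \<in> Tight A" "is_arr L s z x" and eq: "q \<cdot> r2 = f \<cdot> s"
    obtain u where u: "u \<in> Tight A" "is_arr L u X Cf" "Q \<cdot> u = q"
      "reflection_morphism A f' r2 \<eta>2 P r \<eta> u s"
      using lim.universal_reflection_morphism[OF r 2(1,2) q s eq] .
    have "R1 q \<cdot>' r2' = (R1 Q \<cdot>' R1 u) \<cdot>' r2'"
      using R1_comp1[OF u(1,2) lim.projections(2,4)] u(3) by simp
    also have "\<dots> = R1 Q \<cdot>' (R1 u \<cdot>' r2')"
      by (rule B.comp1_assoc[OF lift_arr[OF 2] R1_arr(1)[OF u(1,2)] RQ(1)])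
    also have "\<dots> = R1 Q \<cdot>' (r' \<cdot>' R1 s)"
      using lift_morphism[OF 2(1,3) r(1) l u(4)] by simp
    also have "\<dots> = (R1 Q \<cdot>' r') \<cdot>' R1 s"
      by (rule B.comp1_assoc[OF R1_arr(1)[OF s] r'arr RQ(1), symmetric])
    finally show "R1 q \<cdot>' r2' = (R1 Q \<cdot>' r') \<cdot>' R1 s" .
  qed
  then show ?thesis ..
qed

definition K1 :: "'l1 \<Rightarrow> 'bl1" where "K1 f = (SOME k. extends_at f k)"

lemma K1_extends: "is_arr L f x y \<Longrightarrow> extends_at f (K1 f)"
  unfolding K1_def by (rule someI_ex) (rule extends_at_exists)

lemma K1_arr: "is_arr L f x y \<Longrightarrow> is_arr M (K1 f) (F0 R x) (F0 R y)"
  and H_K1: "is_arr L f x y \<Longrightarrow> F1 H (K1 f) = F1 S f"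
  using K1_extends unfolding extends_at_def by (auto simp: is_arr_def)

lemma K1_square:
  assumes "reflection p A f' r \<eta>" "is_arr L f' X z" "lifts f' r \<eta> r' \<eta>'"
    "q \<in> Tight A" "is_arr L q X y" "s \<in> Tight A" "is_arr L s z x" "q \<cdot> r = f \<cdot> s" "is_arr L f x y"
  shows "R1 q \<cdot>' r' = K1 f \<cdot>' R1 s"
  using K1_extends[OF assms(9)] assms(1-8) unfolding extends_at_def is_arrE(2,3)[OF assms(9)] by blast

lemma K1_eq:
  assumes "reflection p A f' r \<eta>" "is_arr L f' X x" "lifts f' r \<eta> r' \<eta>'"
    "q \<in> Tight A" "is_arr L q X y" "q \<cdot> r = f"
  shows "K1 f = R1 q \<cdot>' r'"
proof -
  have f: "is_arr L f x y"
    using A.comp1_arr[OF A.reflectionD(2)[OF assms(1,2)] assms(5)] assms(6) by simp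
  have x: "x \<in> Ob L" using A.ob_arr f by blast
  have "R1 q \<cdot>' r' = K1 f \<cdot>' R1 (id1 L x)"
    using K1_square[OF assms(1-5) A.tight_id1[OF x] A.id1_arr[OF x] _ f] assms(6) A.id1_right[OF f] by simp
  then show ?thesis using R1_id1[OF x] B.id1_right[OF K1_arr[OF f]] by simp
qed

text \<open>
  A tight \<open>f\<close> is presented as \<open>f \<cdot> 1\<close> over the identity reflection, whose lift is the identity.
\<close>

lemma K1_tight:
  assumes "f \<in> Tight A" "is_arr L f x y"
  shows "K1 f = R1 f"
proof -
  have x: "x \<in> Ob L" using A.ob_arr assms(2) by blast
  show ?thesis
    using K1_eq[OF A.reflection_id1[OF x] A.id1_arr[OF x] lift_id1[OF x] assms A.id1_right[OF assms(2)]]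
      B.id1_right[OF R1_arr(1)[OF assms]] by simp
qed

lemma representation:
  assumes f: "is_arr L f x y"
  obtains X f' r \<eta> q r' \<eta>' where "reflection p A f' r \<eta>" "is_arr L f' X x" "q \<in> Tight A"
    "is_arr L q X y" "q \<cdot> r = f" "lifts f' r \<eta> r' \<eta>'"
proof -
  obtain Cf P lam Q where "colax_limit p A f Cf P lam Q"
    using limits[OF is_arrE(1)[OF f]] by blast
  then interpret lim: loose_limit A L p f Cf P lam Q x y
    by unfold_locales (use f in auto)
  obtain r \<eta> where r: "reflection p A P r \<eta>" "Q \<cdot> r = f" "Q \<lhd>\<^bsub>L\<^esub> \<eta> = lam"
    using lim.projection_reflection .
  obtain r' \<eta>' where l: "lifts P r \<eta> r' \<eta>'" using lift_exists[OF r(1)] .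
  show thesis using that[OF r(1) lim.projections(3,2,4) r(2) l] .
qed

text \<open>
  If \<open>f = q r\<close> and \<open>g q = q\<^sub>2 r\<^sub>2\<close>, then \<open>g f = q\<^sub>2 (r\<^sub>2 r)\<close> is a presentation over the composite of the two
  reflections, so \<open>K (g f) = R q\<^sub>2 \<cdot> r\<^sub>2' \<cdot> r' = K g \<cdot> R q \<cdot> r' = K g \<cdot> K f\<close>. The middle step is the
  characterizing property of \<open>K g\<close> with \<open>s = q\<close>.
\<close>

lemma K1_comp:
  assumes f: "is_arr L f x y" and g: "is_arr L g y z"
  shows "K1 (g \<cdot> f) = K1 g \<cdot>' K1 f"
proof -
  obtain X f1 r \<eta> q r' \<eta>' where 1: "reflection p A f1 r \<eta>" "is_arr L f1 X x" "q \<in> Tight A"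
    "is_arr L q X y" "q \<cdot> r = f" "lifts f1 r \<eta> r' \<eta>'" using representation[OF f] .
  have gq: "is_arr L (g \<cdot> q) X z" using A.comp1_arr[OF 1(4) g] .
  obtain Y f2 r2 \<eta>2 q2 r2' \<eta>2' where 2: "reflection p A f2 r2 \<eta>2" "is_arr L f2 Y X" "q2 \<in> Tight A"
    "is_arr L q2 Y z" "q2 \<cdot> r2 = g \<cdot> q" "lifts f2 r2 \<eta>2 r2' \<eta>2'" using representation[OF gq] .
  note r = A.reflectionD(2)[OF 1(1,2)] and r2 = A.reflectionD(2)[OF 2(1,2)]
  note r' = lift_arr[OF 1(1,2,6)] and r2' = lift_arr[OF 2(1,2,6)]
  note Rq = R1_arr(1)[OF 1(3,4)] and Rq2 = R1_arr(1)[OF 2(3,4)]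
  have "q2 \<cdot> (r2 \<cdot> r) = (g \<cdot> q) \<cdot> r"
    using A.comp1_assoc[OF r r2 2(4)] 2(5) by simp
  also have "\<dots> = g \<cdot> f" using A.comp1_assoc[OF r 1(4) g] 1(5) by simp
  finally have "q2 \<cdot> (r2 \<cdot> r) = g \<cdot> f" .
  then have "K1 (g \<cdot> f) = R1 q2 \<cdot>' (r2' \<cdot>' r')"
    using K1_eq[OF A.reflection_comp[OF 2(1,2) 1(1,2)] A.comp1_arr[OF 2(2) 1(2)]
      lift_comp[OF 2(1,2,6) 1(1,2,6)] 2(3,4)] by blast
  also have "\<dots> = (R1 q2 \<cdot>' r2') \<cdot>' r'"
    using B.comp1_assoc[OF r' r2' Rq2] by simp
  also have "\<dots> = (K1 g \<cdot>' R1 q) \<cdot>' r'"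
    using K1_square[OF 2(1,2,6,3,4) 1(3,4) 2(5) g] by simp
  also have "\<dots> = K1 g \<cdot>' (R1 q \<cdot>' r')"
    using B.comp1_assoc[OF r' Rq K1_arr[OF g]] .
  also have "R1 q \<cdot>' r' = K1 f"
    using K1_eq[OF 1(1,2,6,3,4,5)] by simp
  finally show ?thesis .
qed

section \<open>The filler on 2-cells\<close>

text \<open>
  Presenting \<open>f = q r\<close> over \<open>f\<^sub>1 \<stileturn> r\<close> and then \<open>g f\<^sub>1 = q\<^sub>2 r\<^sub>2\<close> over \<open>f\<^sub>2 \<stileturn> r\<^sub>2\<close> puts both \<open>f\<close> and \<open>g\<close> over
  the composite reflection \<open>f\<^sub>1 f\<^sub>2 \<stileturn> r\<^sub>2 r\<close>, namely \<open>f = (q f\<^sub>2) (r\<^sub>2 r)\<close> and \<open>g = q\<^sub>2 (r\<^sub>2 r)\<close>. So \<open>\<alpha>\<close>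
  extends to a 2-cell between the tight morphisms \<open>q f\<^sub>2\<close> and \<open>q\<^sub>2\<close>, to which \<open>R\<close> applies.
\<close>

lemma cell_lift_pseudo:
  assumes p and \<alpha>: "is_cell L \<alpha> f g" and f: "is_arr L f x y"
  obtains \<beta> where "is_cell M \<beta> (K1 f) (K1 g)" "F2 H \<beta> = F2 S \<alpha>"
proof -
  have g: "is_arr L g x y" using A.cell_trg[OF \<alpha> f] .
  obtain X f1 r \<eta> q r' \<eta>' where 1: "reflection p A f1 r \<eta>" "is_arr L f1 X x" "q \<in> Tight A"
    "is_arr L q X y" "q \<cdot> r = f" "lifts f1 r \<eta> r' \<eta>'" using representation[OF f] .
  have gf1: "is_arr L (g \<cdot> f1) X y" using A.comp1_arr[OF 1(2) g] .
  obtain Y f2 r2 \<eta>2 q2 r2' \<eta>2' where 2: "reflection p A f2 r2 \<eta>2" "is_arr L f2 Y X" "q2 \<in> Tight A"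
    "is_arr L q2 Y y" "q2 \<cdot> r2 = g \<cdot> f1" "lifts f2 r2 \<eta>2 r2' \<eta>2'" using representation[OF gf1] .
  note D = A.reflectionD[OF 1(1,2)] and D2 = A.reflectionD[OF 2(1,2)]
  note c = A.reflection_comp[OF 2(1,2) 1(1,2)] and f12 = A.comp1_arr[OF 2(2) 1(2)]
    and l = lift_comp[OF 2(1,2,6) 1(1,2,6)]
  note rr = A.comp1_arr[OF D(2) D2(2)]
  have qf2: "is_arr L (q \<cdot> f2) Y y" "q \<cdot> f2 \<in> Tight A"
    using A.comp1_arr[OF 2(2) 1(4)] A.tight_comp1[OF D2(1) 1(3) 2(2) 1(4)] .
  have "f2 \<cdot> (r2 \<cdot> r) = r"
    using A.comp1_assoc[OF D(2) D2(2) 2(2), symmetric] A.id1_left[OF D(2)] by (simp only: D2(3))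
  then have src: "(q \<cdot> f2) \<cdot> (r2 \<cdot> r) = f"
    using A.comp1_assoc[OF rr 2(2) 1(4)] 1(5) by simp
  have "q2 \<cdot> (r2 \<cdot> r) = (g \<cdot> f1) \<cdot> r"
    using A.comp1_assoc[OF D(2) D2(2) 2(4)] 2(5) by simp
  then have trg: "q2 \<cdot> (r2 \<cdot> r) = g"
    using A.comp1_assoc[OF D(2) 1(2) g] A.id1_right[OF g] by (simp only: D(3))
  obtain \<gamma> where \<gamma>: "is_cell L \<gamma> (q \<cdot> f2) q2" "\<gamma> \<rhd>\<^bsub>L\<^esub> (r2 \<cdot> r) = \<alpha>"
    using A.pseudo_reflection_cell_extension[OF _ f12 qf2(1) 2(4), of "r2 \<cdot> r" _ \<alpha>] c src trg \<alpha> \<open>p\<close> by auto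
  obtain \<beta> where \<beta>: "is_cell M \<beta> (R1 (q \<cdot> f2)) (R1 q2)" "F2 H \<beta> = F2 S \<gamma>"
    using tight_cell_lift[OF qf2(2) 2(3) \<gamma>(1)] .
  note Rqf = R1_arr(1)[OF qf2(2,1)]
  note r'' = lift_arr[OF c f12 l]
  have "is_cell M (\<beta> \<rhd>\<^bsub>M\<^esub> (r2' \<cdot>' r')) (K1 f) (K1 g)"
    using B.whisker_right_cell[OF \<beta>(1) Rqf r''] K1_eq[OF c f12 l qf2(2,1) src] K1_eq[OF c f12 l 2(3,4) trg] by simp
  moreover have "F1 H (r2' \<cdot>' r') = F1 S (r2 \<cdot> r)" using l unfolding lifts_def by blast
  then have "F2 H (\<beta> \<rhd>\<^bsub>M\<^esub> (r2' \<cdot>' r')) = F2 S \<alpha>"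
    using H.F_whisker_right[OF \<beta>(1) Rqf r''] S.F_whisker_right[OF \<gamma>(1) qf2(1) rr] \<beta>(2) \<gamma>(2) by simp
  ultimately show thesis using that by blast
qed

text \<open>
  The factorization \<open>\<alpha> = Q \<eta> t r\<^sub>1\<close> involves only tight morphisms, a unit and a right adjoint of
  reflections. Replacing the former by their images under \<open>R\<close> and the latter by their lifts
  yields the required 2-cell of \<open>\<bbbB>\<close>.
\<close>

lemma cell_lift_lax:
  assumes "\<not> p" and \<alpha>: "is_cell L \<alpha> f g" and f: "is_arr L f x y"
  obtains \<beta> where "is_cell M \<beta> (K1 f) (K1 g)" "F2 H \<beta> = F2 S \<alpha>"
proof -
  have g: "is_arr L g x y" using A.cell_trg[OF \<alpha> f] .
  obtain X f1 r1 \<eta>1 q r1' \<eta>1' where 1: "reflection p A f1 r1 \<eta>1" "is_arr L f1 X x" "q \<in> Tight A"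
    "is_arr L q X y" "q \<cdot> r1 = f" "lifts f1 r1 \<eta>1 r1' \<eta>1'" using representation[OF f] .
  obtain Cg P lam Q where "colax_limit p A g Cg P lam Q"
    using limits[OF is_arrE(1)[OF g]] by blast
  then interpret lim: loose_limit A L p g Cg P lam Q x y
    by unfold_locales (use g in auto)
  note pr = lim.projections
  obtain r \<eta> where r: "reflection p A P r \<eta>" "Q \<cdot> r = g" "Q \<lhd>\<^bsub>L\<^esub> \<eta> = lam"
    using lim.projection_reflection .
  obtain r' \<eta>' where l: "lifts P r \<eta> r' \<eta>'" using lift_exists[OF r(1)] .
  obtain t where t: "t \<in> Tight A" "is_arr L t X Cg" "P \<cdot> t = f1" "Q \<cdot> t = q"
    "Q \<lhd>\<^bsub>L\<^esub> \<eta> \<rhd>\<^bsub>L\<^esub> (t \<cdot> r1) = \<alpha>"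
    using lim.lax_cell_factorization[OF r(1,3) \<open>\<not> p\<close> 1(1-4)] \<alpha> 1(5) by auto
  have l': "reflection p B (R1 P) r' \<eta>'" "F2 H \<eta>' = F2 S \<eta>"
    and l1': "reflection p B (R1 f1) r1' \<eta>1'" "F1 H r1' = F1 S r1"
    using l 1(6) unfolding lifts_def by blast+
  note D1 = A.reflectionD[OF 1(1,2)] and D = A.reflectionD[OF r(1) pr(3)]
  note RP = R1_arr[OF pr(1,3)] and RQ = R1_arr[OF pr(2,4)] and Rt = R1_arr[OF t(1,2)]
    and Rf1 = R1_arr[OF D1(1) 1(2)]
  note E = B.reflectionD[OF l'(1) RP(1)] and E1 = B.reflectionD[OF l1'(1) Rf1(1)]
  have C1: "is_arr L (id1 L Cg) Cg Cg" and RC: "is_arr M (id1 M (F0 R Cg)) (F0 R Cg) (F0 R Cg)"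
    using A.ob_arr A.id1_arr pr(3) B.ob_arr B.id1_arr RP(1) by blast+
  note tr = A.comp1_arr[OF D1(2) t(2)] and Rtr = B.comp1_arr[OF E1(2) Rt(1)]
  have c1: "is_cell M (\<eta>' \<rhd>\<^bsub>M\<^esub> (R1 t \<cdot>' r1')) (R1 t \<cdot>' r1') ((r' \<cdot>' R1 P) \<cdot>' (R1 t \<cdot>' r1'))"
    using B.whisker_right_cell[OF E(4) RC Rtr] B.id1_left[OF Rtr] by simp
  have "R1 P \<cdot>' (R1 t \<cdot>' r1') = R1 f1 \<cdot>' r1'"
    using B.comp1_assoc[OF E1(2) Rt(1) RP(1)] R1_comp1[OF t(1,2) pr(1,3)] t(3) by simp
  then have "(r' \<cdot>' R1 P) \<cdot>' (R1 t \<cdot>' r1') = r'"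
    using B.comp1_assoc[OF Rtr RP(1) E(2)] E1(3) B.id1_right[OF E(2)] by simp
  then have c2: "is_cell M (\<eta>' \<rhd>\<^bsub>M\<^esub> (R1 t \<cdot>' r1')) (R1 t \<cdot>' r1') r'"
    using c1 by simp
  have "R1 Q \<cdot>' (R1 t \<cdot>' r1') = R1 q \<cdot>' r1'"
    using B.comp1_assoc[OF E1(2) Rt(1) RQ(1)] R1_comp1[OF t(1,2) pr(2,4)] t(4) by simp
  then have "is_cell M (R1 Q \<lhd>\<^bsub>M\<^esub> \<eta>' \<rhd>\<^bsub>M\<^esub> (R1 t \<cdot>' r1')) (K1 f) (K1 g)"
    using B.whisker_left_cell[OF c2 Rtr RQ(1)] K1_eq[OF 1(1,2,6,3,4,5)]
      K1_eq[OF r(1) pr(3) l pr(2,4) r(2)] by simp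
  moreover have "F1 H (R1 t \<cdot>' r1') = F1 S (t \<cdot> r1)"
    using H.F_comp1[OF E1(2) Rt(1)] S.F_comp1[OF D1(2) t(2)] Rt(3) l1'(2) by simp
  then have "F2 H (R1 Q \<lhd>\<^bsub>M\<^esub> \<eta>' \<rhd>\<^bsub>M\<^esub> (R1 t \<cdot>' r1')) = F1 S Q \<lhd>\<^bsub>N\<^esub> F2 S \<eta> \<rhd>\<^bsub>N\<^esub> F1 S (t \<cdot> r1)"
    using H.F_whisker_left[OF c2 Rtr RQ(1)] H.F_whisker_right[OF E(4) RC Rtr] l'(2) RQ(3) by simp
  moreover have "is_cell L (\<eta> \<rhd>\<^bsub>L\<^esub> (t \<cdot> r1)) (t \<cdot> r1) ((r \<cdot> P) \<cdot> (t \<cdot> r1))"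
    using A.whisker_right_cell[OF D(4) C1 tr] A.id1_left[OF tr] by simp
  from S.F_whisker_left[OF this tr pr(4)] S.F_whisker_right[OF D(4) C1 tr] t(5)
  have "F1 S Q \<lhd>\<^bsub>N\<^esub> F2 S \<eta> \<rhd>\<^bsub>N\<^esub> F1 S (t \<cdot> r1) = F2 S \<alpha>" by simp
  ultimately show thesis using that by simp
qed

definition K2 :: "'l2 \<Rightarrow> 'bl2" where
  "K2 \<alpha> = (SOME \<beta>. is_cell M \<beta> (K1 (src L \<alpha>)) (K1 (trg L \<alpha>)) \<and> F2 H \<beta> = F2 S \<alpha>)"

lemma K2_cell: "is_cell L \<alpha> f g \<Longrightarrow> is_cell M (K2 \<alpha>) (K1 f) (K1 g)"
  and H_K2: "is_cell L \<alpha> f g \<Longrightarrow> F2 H (K2 \<alpha>) = F2 S \<alpha>"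
proof -
  assume a: "is_cell L \<alpha> f g"
  have "\<exists>\<beta>. is_cell M \<beta> (K1 f) (K1 g) \<and> F2 H \<beta> = F2 S \<alpha>"
  proof (cases p)
    case True
    show ?thesis by (rule cell_lift_pseudo[OF True a A.cell_arr[OF a]]) blast
  next
    case False
    show ?thesis by (rule cell_lift_lax[OF False a A.cell_arr[OF a]]) blast
  qed
  then have "is_cell M (K2 \<alpha>) (K1 f) (K1 g) \<and> F2 H (K2 \<alpha>) = F2 S \<alpha>"
    unfolding K2_def is_cellE(2,3)[OF a] by (rule someI_ex)
  then show "is_cell M (K2 \<alpha>) (K1 f) (K1 g)" "F2 H (K2 \<alpha>) = F2 S \<alpha>" by blast+
qed

section \<open>Existence and uniqueness of the filler\<close>

definition K :: "('o, 'l1, 'l2, 'bo, 'bl1, 'bl2) twofun" where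
  "K = \<lparr>F0 = restrict (F0 R) (Ob L), F1 = restrict K1 (Arr L), F2 = restrict K2 (Cell L)\<rparr>"

lemma K_simps:
  "x \<in> Ob L \<Longrightarrow> F0 K x = F0 R x"
  "f \<in> Arr L \<Longrightarrow> F1 K f = K1 f"
  "\<alpha> \<in> Cell L \<Longrightarrow> F2 K \<alpha> = K2 \<alpha>"
  by (simp_all add: K_def)

text \<open>
  Local faithfulness turns every equation between values of \<open>K\<close> on 2-cells into the corresponding
  equation for \<open>S\<close>.
\<close>

lemma K2_eqI:
  assumes "is_cell L \<alpha> f g" "is_cell M \<beta> (K1 f) (K1 g)" "F2 H \<beta> = F2 S \<alpha>"
  shows "K2 \<alpha> = \<beta>"
  using faithful[OF K2_cell[OF assms(1)] assms(2)] H_K2[OF assms(1)] assms(3) by simp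

lemma K_two_functor: "two_functor L M K"
  unfolding two_functor_def
proof (intro conjI ballI impI)
  show "F0 K \<in> Ob L \<rightarrow>\<^sub>E Ob M"
    using R.functorial unfolding K_def two_functor_def A.Ob_tight by (auto simp: PiE_iff)
  show "F1 K \<in> Arr L \<rightarrow>\<^sub>E Arr M"
    using K1_arr[OF is_arrI] unfolding K_def by (auto simp: is_arr_def)
  show "F2 K \<in> Cell L \<rightarrow>\<^sub>E Cell M"
    using K2_cell[OF is_cellI] unfolding K_def by (auto simp: is_cell_def)
next
  fix f assume f: "f \<in> Arr L"
  have x: "dom1 L f \<in> Ob L" "cod1 L f \<in> Ob L" using A.ob_arr[OF is_arrI[OF f]] by blast+
  show "dom1 M (F1 K f) = F0 K (dom1 L f)" "cod1 M (F1 K f) = F0 K (cod1 L f)"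
    using K1_arr[OF is_arrI[OF f]] by (auto simp: is_arr_def K_simps f x)
  have "K2 (id2 L f) = id2 M (K1 f)"
    using K2_eqI[OF A.id2_cell[OF f] B.id2_cell'[OF K1_arr[OF is_arrI[OF f]]]]
      H.F_id2[OF K1_arr[OF is_arrI[OF f]]] S.F_id2[OF is_arrI[OF f]] H_K1[OF is_arrI[OF f]] by simp
  then show "F2 K (id2 L f) = id2 M (F1 K f)"
    using is_cellE(1)[OF A.id2_cell[OF f]] f by (simp add: K_simps)
next
  fix x assume x: "x \<in> Ob L"
  show "F1 K (id1 L x) = id1 M (F0 K x)"
    using K1_tight[OF A.tight_id1[OF x] A.id1_arr[OF x]] is_arrE(1)[OF A.id1_arr[OF x]] R1_id1[OF x] x
    by (simp add: K_simps)
next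
  fix f g assume f: "f \<in> Arr L" and g: "g \<in> Arr L" and fg: "cod1 L f = dom1 L g"
  have g': "is_arr L g (cod1 L f) (cod1 L g)" using is_arrI[OF g] fg by simp
  show "F1 K (g \<cdot> f) = F1 K g \<cdot>' F1 K f"
    using K1_comp[OF is_arrI[OF f] g'] is_arrE(1)[OF A.comp1_arr[OF is_arrI[OF f] g']] f g by (simp add: K_simps)
next
  fix \<alpha> assume a: "\<alpha> \<in> Cell L"
  have "src L \<alpha> \<in> Arr L" "trg L \<alpha> \<in> Arr L"
    using A.src_trg_parallel[OF a] by (simp_all add: parallel1_def)
  then show "src M (F2 K \<alpha>) = F1 K (src L \<alpha>)" "trg M (F2 K \<alpha>) = F1 K (trg L \<alpha>)"
    using K2_cell[OF is_cellI[OF a]] a by (simp_all add: K_simps is_cell_def)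
next
  fix \<alpha> \<beta> assume a: "\<alpha> \<in> Cell L" and b: "\<beta> \<in> Cell L" and ab: "trg L \<alpha> = src L \<beta>"
  note a' = is_cellI[OF a]
  have b': "is_cell L \<beta> (trg L \<alpha>) (trg L \<beta>)" using is_cellI[OF b] ab by simp
  note Ka = K2_cell[OF a'] and Kb = K2_cell[OF b']
  have "K2 (\<beta> \<bullet>\<^bsub>L\<^esub> \<alpha>) = K2 \<beta> \<bullet>\<^bsub>M\<^esub> K2 \<alpha>"
    using K2_eqI[OF A.vcomp_cell[OF a' b'] B.vcomp_cell[OF Ka Kb]]
      H.F_vcomp[OF Ka Kb] S.F_vcomp[OF a' b'] H_K2[OF a'] H_K2[OF b'] by simp
  then show "F2 K (\<beta> \<bullet>\<^bsub>L\<^esub> \<alpha>) = F2 K \<beta> \<bullet>\<^bsub>M\<^esub> F2 K \<alpha>"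
    using is_cellE(1)[OF A.vcomp_cell[OF a' b']] a b by (simp add: K_simps)
next
  fix \<alpha> \<beta> assume a: "\<alpha> \<in> Cell L" and b: "\<beta> \<in> Cell L" and ab: "cod1 L (src L \<alpha>) = dom1 L (src L \<beta>)"
  note a' = is_cellI[OF a] and b' = is_cellI[OF b]
  note f = A.cell_arr[OF a'] and f' = A.cell_trg[OF a' A.cell_arr[OF a']]
  have g: "is_arr L (src L \<beta>) (cod1 L (src L \<alpha>)) (cod1 L (src L \<beta>))" using A.cell_arr[OF b'] ab by simp
  note g' = A.cell_trg[OF b' g]
  note Ka = K2_cell[OF a'] and Kb = K2_cell[OF b']
  note c = A.hcomp_cell[OF a' b' ab]
  have co: "cod1 M (K1 (src L \<alpha>)) = dom1 M (K1 (src L \<beta>))"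
    using K1_arr[OF f] K1_arr[OF g] by (simp add: is_arr_def)
  have "is_cell M (K2 \<beta> \<star>\<^bsub>M\<^esub> K2 \<alpha>) (K1 (src L \<beta> \<cdot> src L \<alpha>)) (K1 (trg L \<beta> \<cdot> trg L \<alpha>))"
    using B.hcomp_cell[OF Ka Kb co] K1_comp[OF f g] K1_comp[OF f' g'] by simp
  from K2_eqI[OF c this]
  have "K2 (\<beta> \<star>\<^bsub>L\<^esub> \<alpha>) = K2 \<beta> \<star>\<^bsub>M\<^esub> K2 \<alpha>"
    using H.F_hcomp[OF Ka Kb K1_arr[OF f] K1_arr[OF g]] S.F_hcomp[OF a' b' f g] H_K2[OF a'] H_K2[OF b'] by simp
  then show "F2 K (\<beta> \<star>\<^bsub>L\<^esub> \<alpha>) = F2 K \<beta> \<star>\<^bsub>M\<^esub> F2 K \<alpha>"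
    using is_cellE(1)[OF c] a b by (simp add: K_simps)
qed

lemma K_F_functor: "F_functor A B K"
proof -
  have "F1 K f \<in> Tight B" if tf: "f \<in> Tight A" for f
  proof -
    obtain g where "g \<in> Arr (tight_cat A)" "F1 (incl A) g = f" using tf by (auto simp: Tight_def)
    then have f: "is_arr L f (dom1 L f) (cod1 L f)"
      using A.incl_arr[OF is_arrI] by (auto simp: is_arr_def)
    then show ?thesis
      using K1_tight[OF tf f] R1_arr(2)[OF tf f] by (simp add: K_simps is_arr_def)
  qed
  then show ?thesis using K_two_functor by (auto simp: F_functor_def A.L_eq B.L_eq)
qed

lemma K_restricts: "F_comp (all_tight (tight_cat A)) K (incl A) = R"
proof (rule twofun_eqI[OF F_comp_extensional])
  let ?T = "loose_cat (all_tight (tight_cat A))"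
  have T: "?T = tight_cat A" by (simp add: all_tight_def)
  show "F0 R \<in> extensional (Ob ?T)" "F1 R \<in> extensional (Arr ?T)" "F2 R \<in> extensional (Cell ?T)"
    using two_functor_extensional[OF R.functorial] by (simp_all add: T)
  fix x assume "x \<in> Ob ?T"
  then show "F0 (F_comp (all_tight (tight_cat A)) K (incl A)) x = F0 R x"
    by (simp add: F_comp_apply T A.F0_incl A.Ob_tight K_simps)
next
  let ?T = "loose_cat (all_tight (tight_cat A))"
  have T: "?T = tight_cat A" by (simp add: all_tight_def)
  fix f assume f: "f \<in> Arr ?T"
  then have f': "is_arr (tight_cat A) f (dom1 (tight_cat A) f) (cod1 (tight_cat A) f)"
    by (simp add: T is_arrI)
  note lf = A.incl_arr[OF f'] and tf = A.incl_tight[OF f']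
  show "F1 (F_comp (all_tight (tight_cat A)) K (incl A)) f = F1 R f"
    using f is_arrE(1)[OF lf] K1_tight[OF tf lf] R1_incl[OF is_arrE(1)[OF f']]
    by (simp add: F_comp_apply K_simps)
next
  let ?T = "loose_cat (all_tight (tight_cat A))"
  have T: "?T = tight_cat A" by (simp add: all_tight_def)
  fix \<alpha> assume a: "\<alpha> \<in> Cell ?T"
  then have a': "is_cell (tight_cat A) \<alpha> (src (tight_cat A) \<alpha>) (trg (tight_cat A) \<alpha>)"
    by (simp add: T is_cellI)
  note f = A.incl.dom.cell_arr[OF a'] and g = A.incl.dom.cell_trg[OF a' A.incl.dom.cell_arr[OF a']]
  note c = A.incl.F_cell[OF a']
  have "K1 (F1 (incl A) h) = F1 R h" if "is_arr (tight_cat A) h x y" for h x y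
    using K1_tight[OF A.incl_tight[OF that] A.incl_arr[OF that]] R1_incl[OF is_arrE(1)[OF that]] by simp
  from this[OF f] this[OF g]
  have "K2 (F2 (incl A) \<alpha>) = F2 R \<alpha>"
    using K2_eqI[OF c, of "F2 R \<alpha>"] R.F_cell[OF a'] square2[OF is_cellE(1)[OF a']] by simp
  then show "F2 (F_comp (all_tight (tight_cat A)) K (incl A)) \<alpha> = F2 R \<alpha>"
    using a is_cellE(1)[OF c] by (simp add: F_comp_apply K_simps)
qed

lemma K_lifts: "F_comp A H K = S"
proof (rule twofun_eqI[OF F_comp_extensional])
  show "F0 S \<in> extensional (Ob (loose_cat A))" "F1 S \<in> extensional (Arr (loose_cat A))"
    "F2 S \<in> extensional (Cell (loose_cat A))"
    using two_functor_extensional[OF S.functorial] by (simp_all add: A.L_eq)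
qed (simp_all add: F_comp_apply A.L_eq K_simps square0 H_K1[OF is_arrI] H_K2[OF is_cellI])

text \<open>
  An F-functor \<open>K'\<close> filling the square preserves reflections, so it sends a reflection of \<open>\<bbbA>\<close> to a lift
  of it. Since \<open>K1\<close> is computed by any lift, \<open>K' f = R q \<cdot> K' r = K f\<close> whenever \<open>f = q r\<close> is a presentation.
\<close>

lemma K_unique:
  assumes K': "F_functor A B K'" "F_comp (all_tight (tight_cat A)) K' (incl A) = R" "F_comp A H K' = S"
  shows "K' = K"
proof -
  interpret K': F_fun A L B M K' by unfold_locales (rule K'(1))
  have tight_obj: "F0 K' x = F0 R x" if "x \<in> Ob L" for x
    using F_comp_apply(1)[of x "all_tight (tight_cat A)" K' "incl A"] K'(2) that
    by (simp add: all_tight_def A.Ob_tight A.F0_incl)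
  have tight_arr: "F1 K' f = R1 f" if tf: "f \<in> Tight A" for f
  proof -
    obtain g where g: "g \<in> Arr (tight_cat A)" "F1 (incl A) g = f" using tf by (auto simp: Tight_def)
    then show ?thesis
      using F_comp_apply(2)[of g "all_tight (tight_cat A)" K' "incl A"] K'(2) R1_incl[of g]
      by (simp add: all_tight_def)
  qed
  have HK1: "F1 H (F1 K' f) = F1 S f" if "f \<in> Arr L" for f
    using F_comp_apply(2)[of f A H K'] K'(3) that by (simp add: A.L_eq)
  have HK2: "F2 H (F2 K' \<alpha>) = F2 S \<alpha>" if "\<alpha> \<in> Cell L" for \<alpha>
    using F_comp_apply(3)[of \<alpha> A H K'] K'(3) that by (simp add: A.L_eq)
  have arr: "F1 K' f = K1 f" if f: "is_arr L f x y" for f x y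
  proof -
    obtain X f1 r \<eta> q r' \<eta>' where 1: "reflection p A f1 r \<eta>" "is_arr L f1 X x" "q \<in> Tight A"
      "is_arr L q X y" "q \<cdot> r = f" "lifts f1 r \<eta> r' \<eta>'" using representation[OF f] .
    note D = A.reflectionD[OF 1(1,2)]
    have "lifts f1 r \<eta> (F1 K' r) (F2 K' \<eta>)"
      unfolding lifts_def
      using K'.F_reflection[OF 1(1)] tight_arr[OF D(1)] HK1[OF is_arrE(1)[OF D(2)]] HK2[OF is_cellE(1)[OF D(4)]]
      by simp
    from K1_eq[OF 1(1,2) this 1(3,4,5)] show ?thesis
      using K'.F_comp1[OF D(2) 1(4)] tight_arr[OF 1(3)] 1(5) by simp
  qed
  have cell: "F2 K' \<alpha> = K2 \<alpha>" if a: "is_cell L \<alpha> f g" for \<alpha> f g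
  proof (rule K2_eqI[OF a, symmetric])
    note f = A.cell_arr[OF a]
    show "is_cell M (F2 K' \<alpha>) (K1 f) (K1 g)"
      using K'.F_cell[OF a] unfolding arr[OF f] arr[OF A.cell_trg[OF a f]] .
    show "F2 H (F2 K' \<alpha>) = F2 S \<alpha>" by (rule HK2[OF is_cellE(1)[OF a]])
  qed
  show ?thesis
  proof (rule twofun_eqI[OF two_functor_extensional[OF K'.functorial] two_functor_extensional[OF K_two_functor]])
    show "F0 K' x = F0 K x" if "x \<in> Ob L" for x using that by (simp only: tight_obj K_simps)
    show "F1 K' f = F1 K f" if "f \<in> Arr L" for f using that by (simp only: arr[OF is_arrI] K_simps)
    show "F2 K' \<alpha> = F2 K \<alpha>" if "\<alpha> \<in> Cell L" for \<alpha> using that by (simp only: cell[OF is_cellI] K_simps)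
  qed
qed

theorem unique_filler:
  "\<exists>!K. F_functor A B K \<and> F_comp (all_tight (tight_cat A)) K (incl A) = R \<and> F_comp A H K = S"
proof (rule ex1I)
  show "F_functor A B K \<and> F_comp (all_tight (tight_cat A)) K (incl A) = R \<and> F_comp A H K = S"
    by (intro conjI K_F_functor K_restricts K_lifts)
qed (elim conjE, rule K_unique)

end

section \<open>Reversing 2-cells\<close>

lemma two_co_simps [simp]:
  "Ob (two_co A) = Ob A" "Arr (two_co A) = Arr A" "Cell (two_co A) = Cell A"
  "dom1 (two_co A) = dom1 A" "cod1 (two_co A) = cod1 A" "id1 (two_co A) = id1 A"
  "comp1 (two_co A) = comp1 A" "src (two_co A) = trg A" "trg (two_co A) = src A"
  "id2 (two_co A) = id2 A" "vcomp (two_co A) \<beta> \<alpha> = vcomp A \<alpha> \<beta>" "hcomp (two_co A) = hcomp A"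
  "is_arr (two_co A) = is_arr A" "is_cell (two_co A) \<alpha> f g \<longleftrightarrow> is_cell A \<alpha> g f"
  "parallel1 (two_co A) = parallel1 A"
  by (auto simp: two_co_def is_arr_def is_cell_def parallel1_def fun_eq_iff)

lemma two_co_involutive [simp]: "two_co (two_co A) = A"
  by (simp add: two_co_def)

lemma two_category_co:
  assumes "two_category A"
  shows "two_category (two_co A)"
proof -
  interpret two_category A by fact
  have par: "dom1 A f = dom1 A g" "cod1 A f = cod1 A g" if "is_cell A \<alpha> f g" for \<alpha> f g
    using is_arrE(2,3)[OF cell_trg[OF that cell_arr[OF that]]] by simp_all
  show ?thesis
  proof (unfold_locales; (unfold two_co_simps)?)
    fix f assume f: "f \<in> Arr A"
    show "dom1 A f \<in> Ob A" "cod1 A f \<in> Ob A" using dom_in[OF f] cod_in[OF f] .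
    show "is_cell A (id2 A f) f f" by (rule id2_cell[OF f])
  next
    fix x assume "x \<in> Ob A" then show "is_arr A (id1 A x) x x" by (rule id1_arr)
  next
    fix f g x y z assume "is_arr A f x y" "is_arr A g y z"
    then show "is_arr A (g \<cdot>\<^bsub>A\<^esub> f) x z" "id2 A g \<star>\<^bsub>A\<^esub> id2 A f = id2 A (g \<cdot>\<^bsub>A\<^esub> f)"
      by (rule comp1_arr, rule hcomp_id2)
  next
    fix f g h w x y z assume "is_arr A f w x" "is_arr A g x y" "is_arr A h y z"
    then show "(h \<cdot>\<^bsub>A\<^esub> g) \<cdot>\<^bsub>A\<^esub> f = h \<cdot>\<^bsub>A\<^esub> g \<cdot>\<^bsub>A\<^esub> f" by (rule comp1_assoc)
  next
    fix f x y assume "is_arr A f x y"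
    then show "id1 A y \<cdot>\<^bsub>A\<^esub> f = f" "f \<cdot>\<^bsub>A\<^esub> id1 A x = f" by (rule id1_left, rule id1_right)
  next
    fix \<alpha> assume "\<alpha> \<in> Cell A"
    then show "parallel1 A (trg A \<alpha>) (src A \<alpha>)"
      using src_trg_parallel[of \<alpha>] by (simp add: parallel1_def)
  next
    fix \<alpha> \<beta> f g h assume "is_cell A \<alpha> g f" "is_cell A \<beta> h g"
    then show "is_cell A (\<alpha> \<bullet>\<^bsub>A\<^esub> \<beta>) h f" by (rule vcomp_cell[rotated])
  next
    fix \<alpha> \<beta> \<gamma> f g h k assume "is_cell A \<alpha> g f" "is_cell A \<beta> h g" "is_cell A \<gamma> k h"
    then show "\<alpha> \<bullet>\<^bsub>A\<^esub> \<beta> \<bullet>\<^bsub>A\<^esub> \<gamma> = (\<alpha> \<bullet>\<^bsub>A\<^esub> \<beta>) \<bullet>\<^bsub>A\<^esub> \<gamma>" by (intro vcomp_assoc[symmetric])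
  next
    fix \<alpha> f g assume "is_cell A \<alpha> g f"
    then show "\<alpha> \<bullet>\<^bsub>A\<^esub> id2 A g = \<alpha>" "id2 A f \<bullet>\<^bsub>A\<^esub> \<alpha> = \<alpha>" by (rule id2_right, rule id2_left)
  next
    fix \<alpha> \<beta> f f' g g' assume "is_cell A \<alpha> f' f" "is_cell A \<beta> g' g" "cod1 A f = dom1 A g"
    then show "is_cell A (\<beta> \<star>\<^bsub>A\<^esub> \<alpha>) (g' \<cdot>\<^bsub>A\<^esub> f') (g \<cdot>\<^bsub>A\<^esub> f)"
      by (intro hcomp_cell) (simp_all add: par)
  next
    fix \<alpha> \<beta> \<gamma> f f' g g' h h' assume "is_cell A \<alpha> f' f" "is_cell A \<beta> g' g" "is_cell A \<gamma> h' h"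
      "cod1 A f = dom1 A g" "cod1 A g = dom1 A h"
    then show "(\<gamma> \<star>\<^bsub>A\<^esub> \<beta>) \<star>\<^bsub>A\<^esub> \<alpha> = \<gamma> \<star>\<^bsub>A\<^esub> \<beta> \<star>\<^bsub>A\<^esub> \<alpha>"
      by (intro hcomp_assoc[of \<alpha> f' f \<beta> g' g \<gamma> h' h]) (simp_all add: par)
  next
    fix \<alpha> f f' assume a: "is_cell A \<alpha> f' f"
    show "id2 A (id1 A (cod1 A f)) \<star>\<^bsub>A\<^esub> \<alpha> = \<alpha>" "\<alpha> \<star>\<^bsub>A\<^esub> id2 A (id1 A (dom1 A f)) = \<alpha>"
      using hcomp_unit_left[OF a] hcomp_unit_right[OF a] par[OF a] by simp_all
  next
    fix \<alpha> \<alpha>' \<beta> \<beta>' f f' f'' g g' g''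
    assume "is_cell A \<alpha> f' f" "is_cell A \<alpha>' f'' f'" "is_cell A \<beta> g' g" "is_cell A \<beta>' g'' g'"
      "cod1 A f = dom1 A g"
    then show "(\<beta> \<bullet>\<^bsub>A\<^esub> \<beta>') \<star>\<^bsub>A\<^esub> (\<alpha> \<bullet>\<^bsub>A\<^esub> \<alpha>') = (\<beta> \<star>\<^bsub>A\<^esub> \<alpha>) \<bullet>\<^bsub>A\<^esub> (\<beta>' \<star>\<^bsub>A\<^esub> \<alpha>')"
      by (intro interchange[of \<alpha>' f'' f' \<alpha> f \<beta>' g'' g' \<beta> g]) (simp_all add: par)
  qed
qed

lemma two_functor_co:
  assumes "two_category A" "two_functor A B F"
  shows "two_functor (two_co A) (two_co B) F"
proof -
  interpret two_category A by fact
  have par: "dom1 A (trg A \<alpha>) = dom1 A (src A \<alpha>)" "cod1 A (trg A \<alpha>) = cod1 A (src A \<alpha>)" if "\<alpha> \<in> Cell A" for \<alpha>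
    using src_trg_parallel[OF that] by (simp_all add: parallel1_def)
  show ?thesis using assms(2) by (simp add: two_functor_def par)
qed

lemma F_co_simps [simp]:
  "tight_cat (F_co A) = two_co (tight_cat A)" "loose_cat (F_co A) = two_co (loose_cat A)"
  "incl (F_co A) = incl A" "Tight (F_co A) = Tight A"
  by (simp_all add: F_co_def Tight_def)

lemma F_category_co:
  assumes "F_category A"
  shows "F_category (F_co A)"
  using assms
  by (simp add: F_category_def parallel1_def two_category_co two_functor_co)

lemma F_functor_co_iff:
  assumes "two_category (loose_cat A)"
  shows "F_functor (F_co A) (F_co B) F \<longleftrightarrow> F_functor A B F"
proof
  assume "F_functor (F_co A) (F_co B) F"
  then show "F_functor A B F"
    using two_functor_co[OF two_category_co[OF assms], of "two_co (loose_cat B)" F] by (simp add: F_functor_def)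
next
  assume "F_functor A B F"
  then show "F_functor (F_co A) (F_co B) F"
    using two_functor_co[OF assms, of "loose_cat B" F] by (simp add: F_functor_def)
qed

lemma all_tight_co: "all_tight (two_co A) = F_co (all_tight A)"
  by (simp add: all_tight_def F_co_def two_id_def)

lemma F_comp_co: "F_comp (F_co A) = F_comp A"
  by (simp add: F_comp_def two_comp_def fun_eq_iff)

lemma locally_faithful_co: "locally_faithful (F_co A) F \<longleftrightarrow> locally_faithful A F"
  by (auto simp: locally_faithful_def)

theorem theorem21:
  fixes w :: flavour
    and A :: "('o, 't1, 't2, 'l1, 'l2) fcat"
    and B :: "('bo, 'bt1, 'bt2, 'bl1, 'bl2) fcat"
    and C :: "('co, 'ct1, 'ct2, 'cl1, 'cl2) fcat"
    and H :: "('bo, 'bl1, 'bl2, 'co, 'cl1, 'cl2) twofun"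
    and R :: "('o, 't1, 't2, 'bo, 'bl1, 'bl2) twofun"
    and S :: "('o, 'l1, 'l2, 'co, 'cl1, 'cl2) twofun"
  assumes "F_category A" and "F_category B" and "F_category C"
    and "admits_limits_of_loose (bar w) A"
    and "doctrinal w B C H"
    and "F_functor (all_tight (tight_cat A)) B R"
    and "F_functor A C S"
    and "F_comp (all_tight (tight_cat A)) H R = F_comp (all_tight (tight_cat A)) S (incl A)"
  shows "\<exists>!K. F_functor A B K \<and>
           F_comp (all_tight (tight_cat A)) K (incl A) = R \<and> F_comp A H K = S"
proof (cases w)
  case Lax
  interpret lifting_problem A "loose_cat A" B "loose_cat B" C "loose_cat C" False H R S
    using assms Lax by unfold_locales (auto simp: admits_limits_of_loose_def doctrinal_def)
  show ?thesis by (rule unique_filler)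
next
  case Pseudo
  interpret lifting_problem A "loose_cat A" B "loose_cat B" C "loose_cat C" True H R S
    using assms Pseudo by unfold_locales (auto simp: admits_limits_of_loose_def doctrinal_def)
  show ?thesis by (rule unique_filler)
next
  case Colax
  have loose: "two_category (loose_cat A)" "two_category (loose_cat B)"
    and tight: "two_category (loose_cat (all_tight (tight_cat A)))"
    using assms(1,2) by (simp_all add: F_category_def all_tight_def)
  note co = F_functor_co_iff[OF loose(1)] F_functor_co_iff[OF loose(2)] F_functor_co_iff[OF tight]
  \<comment> \<open>Colax doctrinality of \<open>H\<close> and lax limits in \<open>A\<close> are by definition the lax notions for the duals,
    while fillers are the same on both sides.\<close>
  interpret lifting_problem "F_co A" "loose_cat (F_co A)" "F_co B" "loose_cat (F_co B)"
    "F_co C" "loose_cat (F_co C)" False H R S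
    using assms F_category_co[OF assms(1)] F_category_co[OF assms(2)] F_category_co[OF assms(3)] Colax
    by unfold_locales (auto simp: admits_limits_of_loose_def doctrinal_def co locally_faithful_co all_tight_co F_comp_co)
  show ?thesis using unique_filler by (simp add: co all_tight_co F_comp_co)
qed

end
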